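(* Let $n\ge 2$, let $\Omega\subset\mathbb{R}^n$ be a John domain, and let $s\in(0,1)$, $1<p\le q<\infty$, $a\ge 0$ and $b\in\mathbb{R}$ satisfy $b\le \frac{(n+a)p}{q}+sp-n$ and, additionally, $q\le\frac{np}{n-sp}$ when $p<\frac{n}{s}$. Then there exists a constant $C>0$, independent of $f$, such that for every $f\in C^\infty(\Omega)$ $$ \inf_{c\in\mathbb{R}}\|f-c\|_{L^q(\Omega,d^a)}\le C\left\{\int_\Omega\int_{|x-z|\le d(x)/2}\frac{|f(z)-f(x)|^p}{|z-x|^{n+sp}}\,\delta(x,z)^b\,dz\,dx\right\}^{1/p}. $$
   Context: $d(x)=\mathrm{dist}(x,\partial\Omega)$ for $x\in\Omega$; $\delta(x,z)=\min\{d(x),d(z)\}$; $\|g\|_{L^q(\Omega,d^a)}=\left(\int_\Omega |g(y)|^q d(y)^a\,dy\right)^{1/q}$. Both sides of the inequality are allowed to take the value $+\infty$. John domain: it is assumed that $0\in\Omega$. A bounded domain $\Omega\subset\mathbb{R}^n$ is a John domain if there exist a family of rectifiable curves $\gamma(t,y)$, $0\le t\le 1$, $y\in\Omega$, and positive constants $\lambda,K,C_0$ such that: (1) $\gamma(0,y)=y$ and $\gamma(1,y)=0$; (2) $d(\gamma(t,y))\ge\lambda t$; (3) $|\dot\gamma(t,y)|\le K$, where the dot denotes the derivative in $t$; (4) for all $x,y\in\Omega$ and $r\le\frac12 d(x)$, $\ell(\gamma(y)\cap B(x,r))\le C_0 r$, where $\gamma(y)$ denotes the curve $\gamma(\cdot,y)$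 joining $y$ with $0$ and $\ell$ denotes length. *)

theory Defs
  imports "HOL-Analysis.Analysis"
begin

definition bdist :: "'a::euclidean_space set \<Rightarrow> 'a \<Rightarrow> real" where
  "bdist \<Omega> x = infdist x (frontier \<Omega>)"

definition rectifiable_curve :: "(real \<Rightarrow> 'a::euclidean_space) \<Rightarrow> bool" where
  "rectifiable_curve g \<longleftrightarrow> path g \<and>
     bdd_above {(\<Sum>i<m. dist (g (t i)) (g (t (Suc i)))) | (m::nat) t.
                  mono_on {..m} t \<and> t ` {..m} \<subseteq> {0..1}}"

text \<open>Arc length, counted with multiplicity, of the part of the curve lying in \<open>A\<close>, for a
  Lipschitz parametrization. The derivative exists only almost everywhere and is merely Lebesgue
  measurable, hence the completed measure.\<close>

definition curve_length_in :: "(real \<Rightarrow> 'a::euclidean_space) \<Rightarrow> 'a set \<Rightarrow> ennreal" where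
  "curve_length_in g A =
     (\<integral>\<^sup>+ t \<in> {0..1} \<inter> g -` A. ennreal (norm (vector_derivative g (at t))) \<partial>lebesgue)"

text \<open>The bound \<open>K\<close> on the speed is required almost everywhere in \<open>t\<close>. It would not control the
  curve if the parametrization were only continuous and of bounded variation (Cantor-type
  parametrizations have zero derivative almost everywhere), so the parametrizations are required
  to be Lipschitz, with a constant that may depend on \<open>y\<close>. If the derivative exists everywhere on
  \<open>{0..1}\<close> and is bounded by \<open>K\<close>, both clauses hold.\<close>

definition john_domain :: "'a::euclidean_space set \<Rightarrow> bool" where
  "john_domain \<Omega> \<longleftrightarrow>
     open \<Omega> \<and> connected \<Omega> \<and> bounded \<Omega> \<and> 0 \<in> \<Omega> \<and>
     (\<exists>(\<gamma> :: real \<Rightarrow> 'a \<Rightarrow> 'a) (lam::real) (K::real) (C0::real). lam > 0 \<and> K > 0 \<and> C0 > 0 \<and>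
        (\<forall>y\<in>\<Omega>.
           rectifiable_curve (\<lambda>t. \<gamma> t y) \<and>
           (\<exists>L. L-lipschitz_on {0..1} (\<lambda>t. \<gamma> t y)) \<and>
           \<gamma> 0 y = y \<and> \<gamma> 1 y = 0 \<and>
           (\<forall>t\<in>{0..1}. \<gamma> t y \<in> \<Omega> \<and> bdist \<Omega> (\<gamma> t y) \<ge> lam * t) \<and>
           (AE t in lebesgue_on {0..1}. (\<lambda>t. \<gamma> t y) differentiable (at t) \<and>
              norm (vector_derivative (\<lambda>t. \<gamma> t y) (at t)) \<le> K) \<and>
           (\<forall>x\<in>\<Omega>. \<forall>r. 0 < r \<and> r \<le> bdist \<Omega> x / 2 \<longrightarrow>
              curve_length_in (\<lambda>t. \<gamma> t y) (ball x r) \<le> ennreal (C0 * r))))"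

text \<open>\<open>Ck_on k f S\<close> means \<open>f \<in> C\<^sup>k(S)\<close> for open \<open>S\<close>: a function is of class \<open>C\<^sup>k\<^sup>+\<^sup>1\<close> iff it is
  differentiable and all its first partial derivatives are of class \<open>C\<^sup>k\<close>.\<close>

primrec Ck_on :: "nat \<Rightarrow> ('a::euclidean_space \<Rightarrow> real) \<Rightarrow> 'a set \<Rightarrow> bool" where
  "Ck_on 0 f S \<longleftrightarrow> continuous_on S f"
| "Ck_on (Suc k) f S \<longleftrightarrow> (\<forall>x\<in>S. f differentiable (at x)) \<and>
     (\<forall>i\<in>Basis. Ck_on k (\<lambda>x. frechet_derivative f (at x) i) S)"

definition Cinf_on :: "('a::euclidean_space \<Rightarrow> real) \<Rightarrow> 'a set \<Rightarrow> bool" where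
  "Cinf_on f S \<longleftrightarrow> (\<forall>k. Ck_on k f S)"

text \<open>Meant for exponents \<open>r > 0\<close>.\<close>

definition ennreal_powr :: "ennreal \<Rightarrow> real \<Rightarrow> ennreal" where
  "ennreal_powr x r = (if x = \<infinity> then \<infinity> else ennreal (enn2real x powr r))"

definition weighted_Lnorm ::
    "real \<Rightarrow> real \<Rightarrow> 'a::euclidean_space set \<Rightarrow> ('a \<Rightarrow> real) \<Rightarrow> ennreal" where
  "weighted_Lnorm q a \<Omega> g =
     ennreal_powr (\<integral>\<^sup>+ y \<in> \<Omega>. ennreal (\<bar>g y\<bar> powr q * bdist \<Omega> y powr a) \<partial>lborel) (1 / q)"

end

theory Submission
  imports Defs
begin

text \<open>
  Write \<open>n\<close> for the dimension, \<open>d\<close> for the distance to the boundary and \<open>t\<^sub>k = \<theta>\<^sup>k\<close> for a ratio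
  \<open>\<theta> < 1\<close> close to 1. At time \<open>t\<^sub>k\<close> the curve that joins \<open>y\<close> to \<open>0\<close> passes through the centre of a
  ball \<open>B\<^sub>k\<close> whose radius is a small multiple of \<open>t\<^sub>k\<close>. These balls lie in \<open>\<Omega>\<close>, shrink to \<open>y\<close>, begin
  with a ball about \<open>0\<close> that is the same for all \<open>y\<close>, and consecutive ones are close to each other.
  With \<open>c\<close> the average of \<open>f\<close> over that first ball, \<open>\<bar>f y - c\<bar>\<close> is therefore at most the sum of the
  jumps between consecutive averages. By convexity and the distance estimate for points of \<open>B\<^sub>k\<close>
  (\<open>chain_jump_le\<close>), the \<open>p\<close>-th power of the \<open>k\<close>-th jump is at most a constant times
  \<open>t\<^sub>k\<^sup>s\<^sup>p max (t\<^sub>k) (d y)\<^sup>-\<^sup>b P\<^sub>k(y)\<close>. Here \<open>P\<^sub>k(y)\<close> is the mean, over a ball about \<open>y\<close> of radius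
  comparable to \<open>t\<^sub>k\<close>, of the part of the weighted energy density that pairs of points at distance
  at most about \<open>t\<^sub>k\<close> produce when the kernel is frozen at \<open>t\<^sub>k\<^sup>-\<^sup>n\<^sup>-\<^sup>s\<^sup>p\<close>. For each pair the frozen kernels
  form a geometric series, so these parts add up, over all \<open>k\<close>, to at most a multiple of the full
  energy \<open>E\<close> (\<open>total_osc_le\<close>).

  It remains to sum over \<open>k\<close>. Two bounds on \<open>P\<^sub>k\<close> are available: \<open>P\<^sub>k \<le> t\<^sub>k\<^sup>-\<^sup>n E\<close>, and \<open>P\<^sub>k \<le> \<Sum>\<^sub>j P\<^sub>j\<close>,
  where the right-hand side has integral at most a multiple of \<open>E\<close>. The second bound is what a
  maximal function gives in Hedberg's proof of Sobolev's inequality; here it is free, because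
  \<open>P\<^sub>j\<close> sees only the energy of its own scale. Interpolating between the two bounds gives
  \<open>d\<^sup>a \<bar>f - c\<bar>\<^sup>q \<le> C E\<^sup>q\<^sup>/\<^sup>p\<^sup>-\<^sup>1 \<Sum>\<^sub>j P\<^sub>j\<close> as soon as the geometric sums converge
  (\<open>scale_sum_le\<close>). For scales \<open>t\<^sub>k \<le> d(y)\<close> they do, by subcriticality or, at the critical exponent,
  by Hedberg's splitting. For \<open>t\<^sub>k > d(y)\<close> only the factor \<open>t\<^sub>k\<^sup>-\<^sup>a\<^sup>/\<^sup>q\<close> is left, which does not
  decay if \<open>a = 0\<close>. Decay is then produced by replacing \<open>P\<^sub>k\<close> with \<open>(t\<^sub>k / d(y))\<^sup>\<epsilon> P\<^sub>k\<close> for a small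
  \<open>\<epsilon> > 0\<close>. This does not spoil the integral bound, since \<open>d\<^sup>-\<^sup>\<epsilon>\<close> has scale invariant integrals over balls
  (\<open>porosity_integral\<close>): each point of \<open>\<Omega>\<close> at distance less than \<open>t\<close> from the boundary has, at a
  distance comparable to \<open>t\<close>, a ball of radius comparable to \<open>t\<close> which stays away from the boundary,
  so that the measure of boundary layers decays like a power of their width.
\<close>

section \<open>Lipschitz curves with almost everywhere bounded speed\<close>

text \<open>
  Cover the exceptional null set by an open set \<open>U\<close> of measure less than \<open>e\<close>. From a point outside the
  null set the curve advances, for a short time, at speed at most \<open>K + e\<close>; from a point of \<open>U\<close> it
  advances at speed at most \<open>L\<close>, but the total time spent in \<open>U\<close> is less than \<open>e\<close>. A continuation
  argument adds the local estimates, and \<open>e\<close> tends to 0.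
\<close>
lemma lipschitz_on_of_speed_bound_AE:
  fixes g :: "real \<Rightarrow> 'a::euclidean_space"
  assumes lip: "L-lipschitz_on {0..1} g"
    and ae: "AE t in lebesgue_on {0..1}. g differentiable (at t) \<and>
              norm (vector_derivative g (at t)) \<le> K"
    and K: "K \<ge> 0"
  shows "K-lipschitz_on {0..1} g"
proof -
  have "AE t in lebesgue. t \<in> {0..1} \<longrightarrow> g differentiable (at t) \<and>
              norm (vector_derivative g (at t)) \<le> K"
    using ae by (subst (asm) AE_restrict_space_iff) auto
  then obtain N where N: "N \<in> null_sets lebesgue"
    and good: "\<And>t. t \<in> {0..1} \<Longrightarrow> t \<notin> N \<Longrightarrow> g differentiable (at t) \<and>
              norm (vector_derivative g (at t)) \<le> K"
    by (auto elim!: AE_E3)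
  have L0: "L \<ge> 0" using lip by (rule lipschitz_on_nonneg)
  have step: "dist (g v) (g u) \<le> (K + e) * (v - u) + L * e"
    if uv: "0 \<le> u" "u \<le> v" "v \<le> 1" and e: "e > 0" for u v e
  proof -
    have "N \<in> sets lebesgue" using N by auto
    then obtain U where U: "open U" "N \<subseteq> U" "(U - N) \<in> lmeasurable" "emeasure lebesgue (U - N) < ennreal e"
      using sets_lebesgue_outer_open e by metis
    have Us: "U \<in> sets lebesgue" using U(1) by simp
    have "emeasure lebesgue U = emeasure lebesgue (U - N)"
      using N Us by (simp add: emeasure_Diff_null_set)
    then have Ue: "emeasure lebesgue U < ennreal e" using U(4) by simp
    define m where "m x = measure lebesgue (U \<inter> {u..x})" for x
    have Uf: "U \<inter> {x..y} \<in> fmeasurable lebesgue" for x y :: real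
      by (metis Int_commute Us fmeasurable_Int_fmeasurable lmeasurable_interval(1))
    have madd: "m y = m x + measure lebesgue (U \<inter> {x..y})" if "u \<le> x" "x \<le> y" for x y
    proof -
      have "measure lebesgue (U \<inter> {u..y}) = measure lebesgue ((U \<inter> {u..x}) \<union> (U \<inter> {x..y}))"
        using that by (intro arg_cong[where f="measure lebesgue"]) auto
      also have "\<dots> = measure lebesgue (U \<inter> {u..x}) + measure lebesgue (U \<inter> {x..y})"
      proof (rule measure_Un_AE)
        show "AE t in lebesgue. t \<notin> U \<inter> {u..x} \<or> t \<notin> U \<inter> {x..y}"
        proof (rule AE_I')
          show "{x} \<in> null_sets lebesgue" by (simp add: null_sets_completionI)
        qed auto
      qed (use Uf in auto)
      finally show ?thesis by (simp add: m_def)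
    qed
    have mle: "measure lebesgue (U \<inter> {x..y}) \<le> y - x" if "x \<le> y" for x y
    proof -
      have "measure lebesgue (U \<inter> {x..y}) \<le> measure lebesgue {x..y}"
        by (rule measure_mono_fmeasurable) (use Uf U(1) in auto)
      then show ?thesis using that by simp
    qed
    have mlip: "1-lipschitz_on {u..v} m"
    proof (rule lipschitz_on_leI)
      fix x y assume "x \<in> {u..v}" "y \<in> {u..v}" "x \<le> y"
      then show "dist (m x) (m y) \<le> 1 * dist x y"
        using madd[of x y] mle[of x y] by (simp add: dist_real_def)
    qed simp
    \<comment> \<open>the local estimates add up to the bound \<open>\<Psi>\<close>, so the set of times up to which it holds is closed and cannot end before \<open>v\<close>\<close>
    define \<Psi> where "\<Psi> x = (K + e) * (x - u) + L * m x" for x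
    define A where "A = {x \<in> {u..v}. dist (g x) (g u) \<le> \<Psi> x}"
    have cg: "continuous_on {u..v} g"
      using lipschitz_on_continuous_on[OF lip] by (rule continuous_on_subset) (use uv in auto)
    have cm: "continuous_on {u..v} m" using lipschitz_on_continuous_on[OF mlip] .
    have Aeq: "A = (\<lambda>x. \<Psi> x - dist (g x) (g u)) -` {0..} \<inter> {u..v}"
      unfolding A_def by auto
    have "closed A"
      unfolding Aeq \<Psi>_def by (rule closed_vimage_Int) (auto intro!: continuous_intros cg cm)
    moreover have uA: "u \<in> A" using uv L0 by (auto simp: A_def \<Psi>_def m_def)
    moreover have bA: "bdd_above A" unfolding A_def by auto
    ultimately have SA: "Sup A \<in> A" by (intro closed_contains_Sup) auto
    define x where "x = Sup A"
    have x: "u \<le> x" "x \<le> v" "dist (g x) (g u) \<le> \<Psi> x" using SA by (auto simp: A_def x_def)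
    have "x = v"
    proof (rule ccontr)
      assume "x \<noteq> v"
      then have xv: "x < v" using x by simp
      have "\<exists>y\<in>{x<..v}. dist (g y) (g x) \<le> (K + e) * (y - x) + L * measure lebesgue (U \<inter> {x..y})"
      proof (cases "x \<in> N")
        case True
        then have "x \<in> U" using U by auto
        then obtain r where r: "r > 0" "cball x r \<subseteq> U" using U(1) open_contains_cball by blast
        define y where "y = min v (x + r)"
        have y: "y \<in> {x<..v}" using xv r by (auto simp: y_def)
        have "{x..y} \<subseteq> U" using r(2) by (auto simp: y_def cball_def dist_real_def subset_eq)
        then have "U \<inter> {x..y} = {x..y}" by auto
        then have "measure lebesgue (U \<inter> {x..y}) = y - x" using y by simp
        moreover have "dist (g y) (g x) \<le> L * dist y x"
          using y x uv by (intro lipschitz_onD[OF lip]) auto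
        ultimately have "dist (g y) (g x) \<le> L * measure lebesgue (U \<inter> {x..y})"
          using y by (simp add: dist_real_def)
        moreover have "(K + e) * (y - x) \<ge> 0" using K e y by simp
        ultimately show ?thesis using y by (intro bexI[of _ y]) auto
      next
        case False
        have "x \<in> {0..1}" using x uv by auto
        with good[OF this False] have "(g has_vector_derivative vector_derivative g (at x)) (at x)"
          and nK: "norm (vector_derivative g (at x)) \<le> K"
          by (auto simp: vector_derivative_works)
        then have "(g has_derivative (\<lambda>h. h *\<^sub>R vector_derivative g (at x))) (at x)"
          by (simp add: has_vector_derivative_def)
        then obtain r where r: "r > 0" and
          der: "\<And>y. norm (y - x) < r \<Longrightarrow>
             norm (g y - g x - (y - x) *\<^sub>R vector_derivative g (at x)) \<le> e * norm (y - x)"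
          using e unfolding has_derivative_at_alt by meson
        define y where "y = min v (x + r/2)"
        have y: "y \<in> {x<..v}" using xv r by (auto simp: y_def)
        have yr: "norm (y - x) < r" using r y by (auto simp: y_def min_def split: if_splits)
        have "norm (g y - g x) \<le> norm (g y - g x - (y - x) *\<^sub>R vector_derivative g (at x))
              + norm ((y - x) *\<^sub>R vector_derivative g (at x))"
          using norm_triangle_sub by (metis add.commute diff_add_cancel norm_triangle_ineq)
        also have "\<dots> \<le> e * norm (y - x) + norm (y - x) * K"
          using der[OF yr] nK by (intro add_mono) (auto intro!: mult_left_mono)
        finally have "dist (g y) (g x) \<le> (K + e) * (y - x)"
          using y by (simp add: dist_norm algebra_simps)
        then show ?thesis using y L0 by (intro bexI[of _ y]) (auto intro: add_increasing2)
      qed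
      then obtain y where y: "x < y" "y \<le> v"
        "dist (g y) (g x) \<le> (K + e) * (y - x) + L * measure lebesgue (U \<inter> {x..y})" by auto
      have "dist (g y) (g u) \<le> dist (g y) (g x) + dist (g x) (g u)" by (rule dist_triangle)
      also have "\<dots> \<le> \<Psi> y"
        using y x madd[of x y] by (simp add: \<Psi>_def algebra_simps)
      finally have "y \<in> A" using x y by (auto simp: A_def)
      then have "y \<le> x" using bA by (auto simp: x_def intro: cSup_upper)
      then show False using y by simp
    qed
    then have fin: "dist (g v) (g u) \<le> (K + e) * (v - u) + L * m v" using x by (simp add: \<Psi>_def)
    have "emeasure lebesgue (U \<inter> {u..v}) \<le> emeasure lebesgue U"
      using Us by (intro emeasure_mono) auto
    then have "emeasure lebesgue (U \<inter> {u..v}) < ennreal e" using Ue by simp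
    then have "m v \<le> e"
      using Uf[of u v] e by (simp add: m_def emeasure_eq_measure2 ennreal_less_iff)
    then show ?thesis using fin L0 mult_left_mono[of "m v" e L] by linarith
  qed
  have main: "dist (g v) (g u) \<le> K * (v - u)" if uv: "0 \<le> u" "u \<le> v" "v \<le> 1" for u v
  proof (rule field_le_epsilon)
    fix e :: real assume e: "e > 0"
    define e' where "e' = e / (1 + L)"
    have e': "e' > 0" using e L0 by (simp add: e'_def)
    have "dist (g v) (g u) \<le> (K + e') * (v - u) + L * e'" by (rule step[OF uv e'])
    also have "\<dots> \<le> K * (v - u) + (1 + L) * e'"
      using uv e' mult_left_mono[of "v-u" 1 e'] by (simp add: algebra_simps)
    also have "(1 + L) * e' = e" using L0 by (simp add: e'_def)
    finally show "dist (g v) (g u) \<le> K * (v - u) + e" .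
  qed
  show ?thesis
    by (rule lipschitz_on_leI) (use main K in \<open>auto simp: dist_commute dist_real_def\<close>)
qed

section \<open>Sums over geometric scales\<close>

lemma ennreal_term_le_suminf: "f k \<le> (\<Sum>k. f k)" for f :: "nat \<Rightarrow> ennreal"
  using sum_le_suminf[of f "{k}"] by simp

text \<open>
  The powers \<open>\<theta>\<^sup>k\<close> cross the level \<open>\<tau>\<close> once, and the terms decay geometrically in both directions
  from there. The bound is uniform in \<open>\<tau>\<close>; both the energy and the jumps are summed over the scales with its help.
\<close>
lemma two_sided_geometric_sum:
  fixes \<theta> \<tau> \<alpha> :: real
  assumes th: "0 < \<theta>" "\<theta> < 1" and tau: "\<tau> > 0" and al: "\<alpha> > 0"
  shows "(\<Sum>k. ennreal (min (\<theta>^k / \<tau>) (\<tau> / \<theta>^k) powr \<alpha>)) \<le> ennreal (2 / (1 - \<theta> powr \<alpha>))"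
proof -
  define \<rho> where "\<rho> = \<theta> powr \<alpha>"
  have rho: "0 < \<rho>" "\<rho> < 1"
    using th powr_less_mono2[OF al, of \<theta> 1] by (auto simp: \<rho>_def)
  have pw: "(\<theta> ^ j) powr \<alpha> = \<rho> ^ j" for j
    using th by (simp add: \<rho>_def powr_power powr_powr_swap flip: powr_realpow)
  have geo: "(\<Sum>i<n. \<rho> ^ i) \<le> 1 / (1 - \<rho>)" for n
    using rho by (simp add: sum_gp_strict divide_right_mono)
  obtain k1 where "\<theta> ^ k1 < \<tau>" using real_arch_pow_inv[OF tau th(2)] by blast
  then have ex: "\<exists>k. \<theta> ^ k \<le> \<tau>" by (auto intro: less_imp_le)
  define k0 where "k0 = (LEAST k. \<theta> ^ k \<le> \<tau>)"
  have k0: "\<theta> ^ k0 \<le> \<tau>" unfolding k0_def using ex by (rule LeastI_ex)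
  have k0': "\<tau> < \<theta> ^ k" if "k < k0" for k
    using that not_less_Least[of k "\<lambda>k. \<theta> ^ k \<le> \<tau>"] by (simp add: k0_def)
  define f where "f k = min (\<theta>^k / \<tau>) (\<tau> / \<theta>^k) powr \<alpha>" for k
  have f0: "f k \<ge> 0" for k by (simp add: f_def)
  have hi: "f (k + k0) \<le> \<rho> ^ k" for k
  proof -
    have "\<theta> ^ (k + k0) / \<tau> \<le> \<theta> ^ k"
      using k0 th tau by (simp add: power_add divide_le_eq mult_left_mono)
    then have "f (k + k0) \<le> (\<theta> ^ k) powr \<alpha>"
      unfolding f_def using th tau al by (intro powr_mono2) auto
    then show ?thesis by (simp add: pw)
  qed
  have lo: "f k \<le> \<rho> ^ (k0 - Suc k)" if "k < k0" for k
  proof -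
    have "\<tau> < \<theta> ^ (k0 - 1)" using k0'[of "k0 - 1"] that by simp
    also have "\<theta> ^ (k0 - 1) = \<theta> ^ (k0 - Suc k) * \<theta> ^ k"
      using that by (simp flip: power_add)
    finally have "\<tau> / \<theta> ^ k \<le> \<theta> ^ (k0 - Suc k)"
      using th by (simp add: divide_le_eq)
    then have "f k \<le> (\<theta> ^ (k0 - Suc k)) powr \<alpha>"
      unfolding f_def using th tau al by (intro powr_mono2) auto
    then show ?thesis by (simp add: pw)
  qed
  have part: "(\<Sum>k<n. f k) \<le> 2 / (1 - \<rho>)" for n
  proof -
    have "(\<Sum>k<n. f k) \<le> (\<Sum>k<n+k0. f k)" using f0 by (intro sum_mono2) auto
    also have "\<dots> = (\<Sum>k<k0. f k) + (\<Sum>k<n. f (k + k0))"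
      by (induction n) (simp_all add: add_ac)
    also have "\<dots> \<le> (\<Sum>k<k0. \<rho> ^ (k0 - Suc k)) + (\<Sum>k<n. \<rho> ^ k)"
      using hi lo by (intro add_mono sum_mono) auto
    also have "\<dots> \<le> 1 / (1 - \<rho>) + 1 / (1 - \<rho>)"
      using geo by (subst sum.nat_diff_reindex) (intro add_mono)
    finally show ?thesis by simp
  qed
  have "(\<Sum>k. ennreal (f k)) \<le> ennreal (2 / (1 - \<rho>))"
  proof (rule suminf_le_const)
    fix n
    show "(\<Sum>k<n. ennreal (f k)) \<le> ennreal (2 / (1 - \<rho>))"
      using part[of n] f0 by (subst sum_ennreal) (auto intro: ennreal_leI)
  qed auto
  then show ?thesis by (simp add: f_def \<rho>_def)
qed

text \<open>
  The decay factor in logarithmic coordinates, in which the interpolation inequalities below become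
  linear.
\<close>
lemma min_ratio_powr:
  fixes x y :: real
  assumes "0 < x" "x \<le> y"
  shows "min (x / y) (y / x) powr \<alpha> = exp (\<alpha> * (ln x - ln y))"
    and "min (y / x) (x / y) powr \<alpha> = exp (\<alpha> * (ln x - ln y))"
proof -
  have "x / y \<le> 1" "1 \<le> y / x" using assms by auto
  then have "min (x / y) (y / x) = x / y" by simp
  then show "min (x / y) (y / x) powr \<alpha> = exp (\<alpha> * (ln x - ln y))"
    using assms by (simp add: powr_def ln_div)
  then show "min (y / x) (x / y) powr \<alpha> = exp (\<alpha> * (ln x - ln y))"
    by (simp add: min.commute)
qed

text \<open>
  Summation of the jumps along the chain: \<open>D\<close> stands for the distance of the point to the boundary,
  \<open>P k\<close> for the local energy at scale \<open>\<theta>\<^sup>k\<close>, \<open>E\<close> for the total energy and \<open>Q\<close> for the weighted sum of the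
  local energies at that point. Put \<open>u = 1/p\<close>, \<open>v = 1/q\<close>, \<open>\<sigma> = s - n u + n v\<close>.
  Every term turns out to be at most the claimed bound times a factor that decays geometrically
  away from the scale \<open>D\<close> or away from the scale \<open>\<tau> = (E / Q)\<^sup>1\<^sup>/\<^sup>n\<close> at which the two bounds for \<open>P k\<close>
  coincide.
  Scales above \<open>D\<close>, and all scales if \<open>\<sigma> > 0\<close>, use \<open>P\<^sup>u = P\<^sup>v P\<^sup>u\<^sup>-\<^sup>v\<close> with one bound for each factor; the
  decay comes from the weight \<open>\<epsilon>\<close> and from \<open>\<sigma>\<close>. In the critical case \<open>\<sigma> = 0\<close> below \<open>D\<close> no
  such decay is left, and the better of the two bounds is used on each side of \<open>\<tau>\<close>.
\<close>
lemma scale_sum_le: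
  fixes \<theta> n s p q a b \<epsilon> :: real
  assumes th: "0 < \<theta>" "\<theta> < 1" and n: "n > 0" and s: "s > 0" and p: "p > 0" and q: "p \<le> q" and a: "a \<ge> 0"
    and eps: "\<epsilon> > 0" and sub: "n / p - n / q \<le> s"
    and b: "b / p = a / q + (s - n / p + n / q)"
  obtains C where "C > 0"
    "\<And>D Q E (P :: nat \<Rightarrow> real). D > 0 \<Longrightarrow> Q \<ge> 0 \<Longrightarrow> E > 0 \<Longrightarrow> (\<And>k. P k \<ge> 0) \<Longrightarrow>
       (\<And>k. max 1 (\<theta> ^ k / D) powr \<epsilon> * P k \<le> Q) \<Longrightarrow> (\<And>k. (\<theta> ^ k) powr n * P k \<le> E) \<Longrightarrow>
       (\<Sum>k. ennreal ((\<theta> ^ k) powr s * max (\<theta> ^ k) D powr (- (b / p)) * P k powr (1 / p)))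
         \<le> ennreal (C * (D powr (- (a / q)) * Q powr (1 / q) * E powr (1 / p - 1 / q)))"
proof -
  define u where "u = 1 / p"
  define v where "v = 1 / q"
  define A where "A = a / q"
  define \<beta> where "\<beta> = b / p"
  define \<sigma> where "\<sigma> = s - n * u + n * v"
  have u0: "u > 0" and v0: "v > 0" and vu: "v \<le> u" and A0: "A \<ge> 0"
    using p q a by (auto simp: u_def v_def A_def frac_le)
  have si: "\<sigma> \<ge> 0" and be: "\<beta> = A + s - n * u + n * v"
    using sub b by (auto simp: \<sigma>_def u_def v_def \<beta>_def A_def)
  define \<alpha> where "\<alpha> = min (min (if \<sigma> > 0 then \<sigma> else 1) (\<epsilon> * v)) (min s (n * v))"
  have al: "\<alpha> > 0" using s n v0 eps by (simp add: \<alpha>_def)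
  have al1: "\<alpha> \<le> \<epsilon> * v" "\<alpha> \<le> s" "\<alpha> \<le> n * v" by (auto simp: \<alpha>_def)
  have al2: "\<alpha> \<le> \<sigma>" if "\<sigma> \<noteq> 0" using that si by (auto simp: \<alpha>_def)
  define C where "C = 2 * (2 / (1 - \<theta> powr \<alpha>))"
  have rho: "\<theta> powr \<alpha> < 1" using th powr_less_mono2[OF al, of \<theta> 1] by simp
  have C: "C > 0" using rho by (simp add: C_def)
  show ?thesis
  proof (rule that[OF C])
    fix D Q E :: real and P :: "nat \<Rightarrow> real"
    assume D: "D > 0" and Q: "Q \<ge> 0" and E: "E > 0" and P: "\<And>k. P k \<ge> 0"
      and PQ: "\<And>k. max 1 (\<theta> ^ k / D) powr \<epsilon> * P k \<le> Q" and PE: "\<And>k. (\<theta> ^ k) powr n * P k \<le> E"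
    define Z where "Z = D powr (- A) * Q powr v * E powr (u - v)"
    have Z: "Z \<ge> 0" by (simp add: Z_def)
    define \<tau> where "\<tau> = (E / Q) powr (1 / n)"
    let ?g = "\<lambda>\<tau> k. min (\<theta>^k / \<tau>) (\<tau> / \<theta>^k) powr \<alpha>"
    let ?T = "\<lambda>k. (\<theta> ^ k) powr s * max (\<theta> ^ k) D powr (- \<beta>) * P k powr u"
    have term_bound: "?T k \<le> Z * (?g D k + ?g \<tau> k)" for k
    proof (cases "P k = 0")
      case True
      then show ?thesis using Z by simp
    next
      case False
      define t where "t = \<theta> ^ k"
      have t: "t > 0" using th by (simp add: t_def)
      have Pk: "P k > 0" using P[of k] False by simp
      have "1 * P k \<le> max 1 (\<theta> ^ k / D) powr \<epsilon> * P k"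
        using Pk eps ge_one_powr_ge_zero[of "max 1 (\<theta> ^ k / D)" \<epsilon>] by (intro mult_right_mono) auto
      then have PkQ: "P k \<le> Q" using PQ[of k] by simp
      then have Q': "Q > 0" using Pk by simp
      have tau: "\<tau> > 0" using E Q' by (simp add: \<tau>_def)
      \<comment> \<open>in logarithms every estimate is a nonnegative combination of the two bounds for \<open>P k\<close> and the position of \<open>t\<close> relative to \<open>D\<close> and \<open>\<tau>\<close>\<close>
      define T where "T = ln t"
      define lD where "lD = ln D"
      define lP where "lP = ln (P k)"
      define lQ where "lQ = ln Q"
      define lE where "lE = ln E"
      define lt where "lt = ln \<tau>"
      have lt: "n * lt = lE - lQ"
        using n E Q' by (simp add: lt_def \<tau>_def ln_powr lE_def lQ_def ln_div)
      have lPQ: "lP \<le> lQ" using PkQ Pk by (simp add: lP_def lQ_def)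
      have lPE: "n * T + lP \<le> lE"
      proof -
        have "ln (t powr n * P k) \<le> ln E" using PE[of k, folded t_def] t Pk E by (subst ln_le_cancel_iff) auto
        then show ?thesis using t Pk by (simp add: ln_mult ln_powr T_def lP_def lE_def)
      qed
      have Zexp: "Z = exp (- A * lD + v * lQ + (u - v) * lE)"
        using D Q' E by (simp add: Z_def powr_def lD_def lQ_def lE_def exp_add exp_diff exp_minus divide_inverse)
      show ?thesis
      proof (cases "t \<le> D")
        case False
        then have Dt: "D < t" by simp
        have g: "?g D k = exp (\<alpha> * (lD - T))"
          using min_ratio_powr(2)[of D t \<alpha>] Dt D by (simp add: t_def lD_def T_def)
        have f1: "lP \<le> lQ - \<epsilon> * (T - lD)"
        proof -
          have "(t / D) powr \<epsilon> * P k \<le> Q" using PQ[of k] Dt D by (simp add: t_def max_def split: if_splits)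
          then have "ln ((t / D) powr \<epsilon> * P k) \<le> lQ" unfolding lQ_def using t D Pk Q' by (subst ln_le_cancel_iff) auto
          then show ?thesis using t D Pk by (simp add: ln_mult ln_powr ln_div T_def lD_def lP_def)
        qed
        have f2: "lD \<le> T" using Dt D by (simp add: lD_def T_def)
        have 1: "v * lP \<le> v * (lQ - \<epsilon> * (T - lD))" using f1 v0 by (intro mult_left_mono) auto
        have 2: "(u - v) * (n * T + lP) \<le> (u - v) * lE" using lPE vu by (intro mult_left_mono) auto
        have 3: "A * lD \<le> A * T" using f2 A0 by (rule mult_left_mono)
        have 4: "\<alpha> * (T - lD) \<le> \<epsilon> * v * (T - lD)" using f2 al1 by (intro mult_right_mono) auto
        have "s * T - \<beta> * T + u * lP \<le> (- A * lD + v * lQ + (u - v) * lE) + \<alpha> * (lD - T)"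
          using 1 2 3 4 unfolding be by (simp add: algebra_simps)
        moreover have "?T k = exp (s * T - \<beta> * T + u * lP)"
          using Dt t Pk by (simp add: t_def[symmetric] powr_def T_def lP_def exp_add exp_diff exp_minus field_simps)
        ultimately have "?T k \<le> Z * ?g D k" unfolding g Zexp by (simp flip: exp_add)
        then show ?thesis using Z by (simp add: distrib_left add_increasing2)
      next
        case True
        have Tform: "?T k = exp (s * T - \<beta> * lD + u * lP)"
          using True t Pk D by (simp add: t_def[symmetric] max_def powr_def T_def lP_def lD_def exp_add exp_diff exp_minus field_simps)
        have f2: "T \<le> lD" using True D t by (simp add: lD_def T_def)
        show ?thesis
        proof (cases "\<sigma> = 0")
          case False
          have g: "?g D k = exp (\<alpha> * (T - lD))"
          using min_ratio_powr(1)[of t D \<alpha>] True t by (simp add: t_def lD_def T_def)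
          have 1: "v * lP \<le> v * lQ" using lPQ v0 by (intro mult_left_mono) auto
          have 2: "(u - v) * (n * T + lP) \<le> (u - v) * lE" using lPE vu by (intro mult_left_mono) auto
          have 4: "\<alpha> * (lD - T) \<le> \<sigma> * (lD - T)" using f2 al2[OF False] by (intro mult_right_mono) auto
          have "s * T - \<beta> * lD + u * lP \<le> (- A * lD + v * lQ + (u - v) * lE) + \<alpha> * (T - lD)"
            using 1 2 4 unfolding be \<sigma>_def by (simp add: algebra_simps)
          then have "?T k \<le> Z * ?g D k" unfolding g Zexp Tform by (simp flip: exp_add)
          then show ?thesis using Z by (simp add: distrib_left add_increasing2)
        next
          case s0: True
          then have sn: "s = n * (u - v)" and bA: "\<beta> = A" by (auto simp: \<sigma>_def be algebra_simps)
          have us: "(u - v) * lQ = (u - v) * lE - s * lt"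
          proof -
            have "(u - v) * (n * lt) = (u - v) * (lE - lQ)" by (simp only: lt)
            then show ?thesis unfolding sn by (simp add: algebra_simps)
          qed
          have vs: "v * lQ = v * lE - n * v * lt"
          proof -
            have "v * (n * lt) = v * (lE - lQ)" by (simp only: lt)
            then show ?thesis by (simp add: algebra_simps)
          qed
          have "?T k \<le> Z * ?g \<tau> k"
          proof (cases "t \<le> \<tau>")
            case True
            have g: "?g \<tau> k = exp (\<alpha> * (T - lt))"
          using min_ratio_powr(1)[of t \<tau> \<alpha>] True t by (simp add: t_def lt_def T_def)
            have "T \<le> lt" using True t by (simp add: lt_def T_def)
            then have 1: "\<alpha> * (lt - T) \<le> s * (lt - T)" using al1 by (intro mult_right_mono) auto
            have 2: "u * lP \<le> u * lQ" using lPQ u0 by (intro mult_left_mono) auto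
            have "s * T - \<beta> * lD + u * lP \<le> (- A * lD + v * lQ + (u - v) * lE) + \<alpha> * (T - lt)"
              using 1 2 us unfolding bA by (simp add: algebra_simps)
            then show ?thesis unfolding g Zexp Tform by (simp flip: exp_add)
          next
            case False
            have g: "?g \<tau> k = exp (\<alpha> * (lt - T))"
          using min_ratio_powr(2)[of \<tau> t \<alpha>] False tau by (simp add: t_def lt_def T_def)
            have "lt \<le> T" using False tau t by (simp add: lt_def T_def)
            then have 1: "\<alpha> * (T - lt) \<le> n * v * (T - lt)" using al1 by (intro mult_right_mono) auto
            have 2: "u * (n * T + lP) \<le> u * lE" using lPE u0 by (intro mult_left_mono) auto
            have "s * T - \<beta> * lD + u * lP \<le> (- A * lD + v * lQ + (u - v) * lE) + \<alpha> * (lt - T)"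
              using 1 2 vs unfolding bA sn by (simp add: algebra_simps)
            then show ?thesis unfolding g Zexp Tform by (simp flip: exp_add)
          qed
          then show ?thesis using Z by (simp add: distrib_left add_increasing)
        qed
      qed
    qed
    show "(\<Sum>k. ennreal ((\<theta> ^ k) powr s * max (\<theta> ^ k) D powr (- (b / p)) * P k powr (1 / p)))
         \<le> ennreal (C * (D powr (- (a / q)) * Q powr (1 / q) * E powr (1 / p - 1 / q)))"
    proof (cases "Q = 0")
      case True
      have "P k = 0" for k
        using PQ[of k] P[of k] True by (smt (verit) mult_pos_pos powr_gt_zero)
      then show ?thesis by simp
    next
      case False
      then have tau: "\<tau> > 0" using Q E by (simp add: \<tau>_def)
      have "(\<Sum>k. ennreal (?T k)) \<le> (\<Sum>k. ennreal Z * (ennreal (?g D k) + ennreal (?g \<tau> k)))"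
      proof (intro suminf_le allI)
        fix k
        have "ennreal (?T k) \<le> ennreal (Z * (?g D k + ?g \<tau> k))" by (intro ennreal_leI term_bound)
        then show "ennreal (?T k) \<le> ennreal Z * (ennreal (?g D k) + ennreal (?g \<tau> k))"
          using Z by (simp add: ennreal_mult)
      qed auto
      also have "\<dots> = ennreal Z * ((\<Sum>k. ennreal (?g D k)) + (\<Sum>k. ennreal (?g \<tau> k)))"
        by (subst ennreal_suminf_cmult, subst suminf_add) auto
      also have "\<dots> \<le> ennreal Z * (ennreal (2 / (1 - \<theta> powr \<alpha>)) + ennreal (2 / (1 - \<theta> powr \<alpha>)))"
        using th D tau al by (intro mult_left_mono add_mono two_sided_geometric_sum) auto
      also have "\<dots> = ennreal (C * Z)"
        using Z rho by (simp add: C_def mult_ac flip: ennreal_mult ennreal_plus)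
      finally show ?thesis by (simp add: Z_def u_def v_def A_def \<beta>_def)
    qed
  qed
qed

section \<open>Integrals and averages over balls\<close>

lemma nn_integral_indicator_plus_series:
  fixes c :: "nat \<Rightarrow> ennreal"
  assumes [measurable]: "B \<in> sets M" "\<And>m. S m \<in> sets M"
  shows "(\<integral>\<^sup>+y. indicator B y + (\<Sum>m. c m * indicator (S m) y) \<partial>M)
       = emeasure M B + (\<Sum>m. c m * emeasure M (S m))"
proof -
  have m: "(\<lambda>y. \<Sum>m. c m * indicator (S m) y) \<in> borel_measurable M" by measurable
  have "(\<integral>\<^sup>+y. indicator B y + (\<Sum>m. c m * indicator (S m) y) \<partial>M)
      = (\<integral>\<^sup>+y. indicator B y \<partial>M) + (\<integral>\<^sup>+y. (\<Sum>m. c m * indicator (S m) y) \<partial>M)"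
    by (rule nn_integral_add[OF _ m]) simp
  also have "(\<integral>\<^sup>+y. (\<Sum>m. c m * indicator (S m) y) \<partial>M) = (\<Sum>m. \<integral>\<^sup>+y. c m * indicator (S m) y \<partial>M)"
    by (rule nn_integral_suminf) simp
  finally show ?thesis by (simp add: nn_integral_cmult)
qed

text \<open>
  Tonelli, with the symmetric relation \<open>dist x y < r\<close> as kernel.
\<close>
lemma nn_integral_ball_swap:
  fixes F G :: "'a::euclidean_space \<Rightarrow> ennreal"
  assumes [measurable]: "F \<in> borel_measurable borel" "G \<in> borel_measurable borel"
  shows "(\<integral>\<^sup>+y. F y * (\<integral>\<^sup>+x. G x * indicator (ball y r) x \<partial>lborel) \<partial>lborel)
       = (\<integral>\<^sup>+x. G x * (\<integral>\<^sup>+y. F y * indicator (ball x r) y \<partial>lborel) \<partial>lborel)"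
proof -
  let ?I = "\<lambda>x y. indicator {p::'a \<times> 'a. dist (fst p) (snd p) < r} (x, y) :: ennreal"
  have Im: "{p::'a \<times> 'a. dist (fst p) (snd p) < r} \<in> sets (borel \<Otimes>\<^sub>M borel)"
    unfolding borel_prod by (intro borel_open open_Collect_less continuous_intros)
  have [measurable]: "(\<lambda>(x, y). ?I x y) \<in> borel_measurable (borel \<Otimes>\<^sub>M borel)"
    using Im by (simp add: case_prod_beta')
  have "(\<integral>\<^sup>+y. F y * (\<integral>\<^sup>+x. G x * indicator (ball y r) x \<partial>lborel) \<partial>lborel)
      = (\<integral>\<^sup>+y. (\<integral>\<^sup>+x. F y * (G x * ?I x y) \<partial>lborel) \<partial>lborel)"
    by (subst nn_integral_cmult[symmetric]) (auto intro!: nn_integral_cong simp: indicator_def dist_commute)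
  also have "\<dots> = (\<integral>\<^sup>+x. (\<integral>\<^sup>+y. F y * (G x * ?I x y) \<partial>lborel) \<partial>lborel)"
  proof (rule lborel_pair.Fubini')
    show "(\<lambda>(x, y). F y * (G x * ?I x y)) \<in> borel_measurable (lborel \<Otimes>\<^sub>M lborel)"
      by measurable
  qed
  also have "\<dots> = (\<integral>\<^sup>+x. G x * (\<integral>\<^sup>+y. F y * indicator (ball x r) y \<partial>lborel) \<partial>lborel)"
    by (subst nn_integral_cmult[symmetric]) (auto intro!: nn_integral_cong simp: indicator_def mult_ac)
  finally show ?thesis .
qed

definition avg :: "('a::euclidean_space \<Rightarrow> real) \<Rightarrow> 'a set \<Rightarrow> real" where
  "avg f B = (LINT x:B|lborel. f x) / measure lborel B"

text \<open>
  Jensen's inequality up to the factor \<open>2\<^sup>p\<close>, which spares the convexity theory: if \<open>A\<^sup>p\<close>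
  exceeds the mean of \<open>\<bar>v - f\<bar>\<^sup>p\<close>, then integrating \<open>u \<le> A + A\<^sup>1\<^sup>-\<^sup>p u\<^sup>p\<close> for \<open>u = \<bar>v - f\<bar>\<close> bounds the mean of
  \<open>\<bar>v - f\<bar>\<close> by \<open>2 A\<close>.
\<close>
lemma avg_deviation_powr_le:
  fixes f :: "'a::euclidean_space \<Rightarrow> real"
  assumes f: "set_integrable lborel B f" and B: "B \<in> fmeasurable lborel" and pos: "measure lborel B > 0"
    and p: "p \<ge> 1"
  shows "ennreal (\<bar>v - avg f B\<bar> powr p) \<le>
     ennreal (2 powr p / measure lborel B) * (\<integral>\<^sup>+z\<in>B. ennreal (\<bar>v - f z\<bar> powr p) \<partial>lborel)"
proof -
  let ?m = "measure lborel B" and ?I = "\<integral>\<^sup>+z\<in>B. ennreal (\<bar>v - f z\<bar> powr p) \<partial>lborel"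
  have Bs[measurable]: "B \<in> sets lborel" using B by (rule fmeasurableD)
  have const: "set_integrable lborel B (\<lambda>_. v)"
    using B by (auto simp: set_integrable_def fmeasurable_def)
  have vf: "set_integrable lborel B (\<lambda>z. v - f z)" by (rule set_integral_diff(1)[OF const f])
  have vf_meas: "(\<lambda>z. indicator B z * \<bar>v - f z\<bar>) \<in> borel_measurable lborel"
  proof -
    have "(\<lambda>z. \<bar>indicator B z *\<^sub>R (v - f z)\<bar>) \<in> borel_measurable lborel"
      using vf unfolding set_integrable_def by measurable
    then show ?thesis by (simp add: abs_mult)
  qed
  have dev: "ennreal (\<bar>v - avg f B\<bar> * ?m) \<le> (\<integral>\<^sup>+z. ennreal (indicator B z * \<bar>v - f z\<bar>) \<partial>lborel)"
  proof -
    have "(LINT z:B|lborel. v - f z) = ?m * v - (LINT x:B|lborel. f x)"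
      using set_integral_diff(2)[OF const f] B by (simp add: set_lebesgue_integral_def fmeasurable_def)
    also have "\<dots> = (v - avg f B) * ?m" using pos by (simp add: avg_def field_simps)
    finally have "ennreal (\<bar>v - avg f B\<bar> * ?m) = ennreal (norm (LINT z:B|lborel. v - f z))"
      using pos by (simp add: abs_mult)
    also have "\<dots> \<le> (\<integral>\<^sup>+z. ennreal (norm (indicator B z *\<^sub>R (v - f z))) \<partial>lborel)"
      unfolding set_lebesgue_integral_def
      by (rule integral_norm_bound_ennreal) (use vf in \<open>simp add: set_integrable_def\<close>)
    finally show ?thesis by (simp add: abs_mult)
  qed
  show ?thesis
  proof (cases "?I = \<infinity>")
    case True
    then show ?thesis using pos by (simp add: ennreal_mult_top)
  next
    case False
    then obtain i where i: "i \<ge> 0" "?I = ennreal i" by (cases ?I) auto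
    have key: "\<bar>v - avg f B\<bar> powr p \<le> 2 powr p / ?m * i + e" if e: "e > 0" for e
    proof -
      \<comment> \<open>the small excess keeps \<open>A\<close> positive even if \<open>f\<close> equals \<open>v\<close> almost everywhere\<close>
      define \<delta> where "\<delta> = e / 2 powr p"
      have de: "\<delta> > 0" using e by (simp add: \<delta>_def)
      define A where "A = (i / ?m + \<delta>) powr (1 / p)"
      have s0: "i / ?m + \<delta> > 0" using i pos de by (simp add: add_nonneg_pos)
      have A: "A > 0" using s0 by (simp add: A_def)
      have Ap: "A powr p = i / ?m + \<delta>" using s0 p by (simp add: A_def powr_powr)
      have "i \<le> ?m * A powr p" using pos de by (simp add: Ap field_simps)
      then have iA: "A powr (1 - p) * i \<le> A powr (1 - p) * (?m * A powr p)"
        by (intro mult_left_mono) auto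
      also have "\<dots> = A * ?m"
        using A by (simp add: powr_diff)
      finally have iA: "A powr (1 - p) * i \<le> A * ?m" .
      have pt: "u \<le> A + A powr (1 - p) * u powr p" if "u \<ge> 0" for u :: real
      proof (cases "u \<le> A")
        case False
        have "u = u powr (1 - p) * u powr p" using False A by (simp add: powr_diff)
        also have "\<dots> \<le> A powr (1 - p) * u powr p"
          using False A p by (intro mult_right_mono powr_mono2') auto
        finally show ?thesis using A by simp
      qed (auto intro: add_increasing2)
      have "ennreal (\<bar>v - avg f B\<bar> * ?m) \<le> (\<integral>\<^sup>+z. ennreal (indicator B z * \<bar>v - f z\<bar>) \<partial>lborel)"
        by (rule dev)
      also have "\<dots> \<le> (\<integral>\<^sup>+z. ennreal A * indicator B z
            + ennreal (A powr (1 - p)) * (ennreal (\<bar>v - f z\<bar> powr p) * indicator B z) \<partial>lborel)"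
        using pt A by (intro nn_integral_mono)
          (auto simp: indicator_def simp flip: ennreal_mult ennreal_plus intro!: ennreal_leI)
      also have "\<dots> = ennreal A * ennreal ?m + ennreal (A powr (1 - p)) * ?I"
      proof -
        have m: "(\<lambda>z. ennreal (\<bar>v - f z\<bar> powr p) * indicator B z) \<in> borel_measurable lborel"
        proof -
          have "(\<lambda>z. ennreal ((indicator B z * \<bar>v - f z\<bar>) powr p)) \<in> borel_measurable lborel"
            using vf_meas by measurable
          also have "(\<lambda>z. ennreal ((indicator B z * \<bar>v - f z\<bar>) powr p)) = (\<lambda>z. ennreal (\<bar>v - f z\<bar> powr p) * indicator B z)"
            by (auto simp: indicator_def)
          finally show ?thesis .
        qed
        have "(\<integral>\<^sup>+z. ennreal A * indicator B z
            + ennreal (A powr (1 - p)) * (ennreal (\<bar>v - f z\<bar> powr p) * indicator B z) \<partial>lborel)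
          = (\<integral>\<^sup>+z. ennreal A * indicator B z \<partial>lborel) + (\<integral>\<^sup>+z. ennreal (A powr (1 - p)) * (ennreal (\<bar>v - f z\<bar> powr p) * indicator B z) \<partial>lborel)"
          using m by (intro nn_integral_add) auto
        then show ?thesis using m B nn_integral_indicator[OF Bs]
          by (simp add: nn_integral_cmult emeasure_eq_measure2)
      qed
      also have "\<dots> = ennreal (A * ?m + A powr (1 - p) * i)"
        using A i pos by (simp add: ennreal_mult)
      finally have "\<bar>v - avg f B\<bar> * ?m \<le> A * ?m + A powr (1 - p) * i"
        by (subst (asm) ennreal_le_iff) (use A pos i in auto)
      then have "\<bar>v - avg f B\<bar> * ?m \<le> (2 * A) * ?m" using iA by simp
      then have "\<bar>v - avg f B\<bar> \<le> 2 * A" using pos by simp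
      then have "\<bar>v - avg f B\<bar> powr p \<le> (2 * A) powr p" using p by (intro powr_mono2) auto
      also have "\<dots> = 2 powr p * (i / ?m + \<delta>)" using A by (simp add: powr_mult Ap)
      also have "\<dots> = 2 powr p / ?m * i + e" by (simp add: \<delta>_def field_simps)
      finally show ?thesis .
    qed
    have "\<bar>v - avg f B\<bar> powr p \<le> 2 powr p / ?m * i"
      by (rule field_le_epsilon) (rule key)
    then show ?thesis using i pos by (simp add: ennreal_leI flip: ennreal_mult)
  qed
qed

lemma avg_diff_powr_le:
  fixes f :: "'a::euclidean_space \<Rightarrow> real"
  assumes [measurable]: "f \<in> borel_measurable borel"
    and f: "set_integrable lborel B f" and B: "B \<in> fmeasurable lborel" and pos: "measure lborel B > 0"
    and f': "set_integrable lborel B' f" and B': "B' \<in> fmeasurable lborel" and pos': "measure lborel B' > 0"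
    and p: "p \<ge> 1"
  shows "ennreal (\<bar>avg f B' - avg f B\<bar> powr p) \<le>
     ennreal (4 powr p / (measure lborel B * measure lborel B')) *
       (\<integral>\<^sup>+x\<in>B. (\<integral>\<^sup>+z\<in>B'. ennreal (\<bar>f z - f x\<bar> powr p) \<partial>lborel) \<partial>lborel)"
proof -
  let ?c = "2 powr p / measure lborel B" and ?c' = "2 powr p / measure lborel B'"
  have [measurable]: "B' \<in> sets borel" "B \<in> sets borel" using B B' by (auto dest: fmeasurableD)
  have "ennreal (\<bar>avg f B' - avg f B\<bar> powr p)
      \<le> ennreal ?c * (\<integral>\<^sup>+x\<in>B. ennreal (\<bar>avg f B' - f x\<bar> powr p) \<partial>lborel)"
    by (rule avg_deviation_powr_le[OF f B pos p])
  also have "\<dots> \<le> ennreal ?c * (\<integral>\<^sup>+x\<in>B. (ennreal ?c' * (\<integral>\<^sup>+z\<in>B'. ennreal (\<bar>f z - f x\<bar> powr p) \<partial>lborel)) \<partial>lborel)"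
  proof (intro mult_left_mono nn_integral_mono mult_right_mono)
    fix x
    have "ennreal (\<bar>f x - avg f B'\<bar> powr p)
      \<le> ennreal ?c' * (\<integral>\<^sup>+z\<in>B'. ennreal (\<bar>f x - f z\<bar> powr p) \<partial>lborel)"
      by (rule avg_deviation_powr_le[OF f' B' pos' p])
    then show "ennreal (\<bar>avg f B' - f x\<bar> powr p)
      \<le> ennreal ?c' * (\<integral>\<^sup>+z\<in>B'. ennreal (\<bar>f z - f x\<bar> powr p) \<partial>lborel)"
      by (simp add: abs_minus_commute)
  qed auto
  also have "\<dots> = ennreal ?c * (ennreal ?c' * (\<integral>\<^sup>+x\<in>B. (\<integral>\<^sup>+z\<in>B'. ennreal (\<bar>f z - f x\<bar> powr p) \<partial>lborel) \<partial>lborel))"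
    by (subst nn_integral_cmult[symmetric]) (auto simp: mult.assoc)
  also have "\<dots> = ennreal (?c * ?c') * (\<integral>\<^sup>+x\<in>B. (\<integral>\<^sup>+z\<in>B'. ennreal (\<bar>f z - f x\<bar> powr p) \<partial>lborel) \<partial>lborel)"
    by (subst ennreal_mult) (auto simp: mult.assoc)
  also have "?c * ?c' = 4 powr p / (measure lborel B * measure lborel B')"
    by (simp flip: powr_mult)
  finally show ?thesis .
qed

lemma ennreal_abs_limit_le_suminf:
  fixes a :: "nat \<Rightarrow> real"
  assumes "a \<longlonglongrightarrow> L"
  shows "ennreal \<bar>L - a 0\<bar> \<le> (\<Sum>k. ennreal \<bar>a (Suc k) - a k\<bar>)"
proof (rule LIMSEQ_le_const2)
  show "(\<lambda>n. ennreal \<bar>a n - a 0\<bar>) \<longlonglongrightarrow> ennreal \<bar>L - a 0\<bar>"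
    by (intro tendsto_ennrealI tendsto_intros assms)
  have "ennreal \<bar>a n - a 0\<bar> \<le> (\<Sum>k. ennreal \<bar>a (Suc k) - a k\<bar>)" for n
  proof -
    have "a n - a 0 = (\<Sum>k<n. a (Suc k) - a k)" by (simp add: sum_lessThan_telescope)
    then have "ennreal \<bar>a n - a 0\<bar> \<le> ennreal (\<Sum>k<n. \<bar>a (Suc k) - a k\<bar>)"
      by (simp add: ennreal_leI)
    also have "\<dots> = (\<Sum>k<n. ennreal \<bar>a (Suc k) - a k\<bar>)" by (subst sum_ennreal) auto
    also have "\<dots> \<le> (\<Sum>k. ennreal \<bar>a (Suc k) - a k\<bar>)" by (rule sum_le_suminf) auto
    finally show ?thesis .
  qed
  then show "\<exists>N. \<forall>n\<ge>N. ennreal \<bar>a n - a 0\<bar> \<le> (\<Sum>k. ennreal \<bar>a (Suc k) - a k\<bar>)" by blast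
qed

section \<open>Domains with John curves\<close>

text \<open>
  The normalization \<open>lam \<le> 1 \<le> K\<close> makes times, radii and distances along a curve comparable without
  case distinctions.
\<close>
locale john_curves =
  fixes \<Omega> :: "'a::euclidean_space set" and \<gamma> :: "real \<Rightarrow> 'a \<Rightarrow> 'a" and lam K :: real
  assumes open_dom: "open \<Omega>" and bounded_dom: "bounded \<Omega>" and zero_in: "0 \<in> \<Omega>"
    and lam: "0 < lam" "lam \<le> 1" and K: "1 \<le> K"
    and start: "y \<in> \<Omega> \<Longrightarrow> \<gamma> 0 y = y" and finish: "y \<in> \<Omega> \<Longrightarrow> \<gamma> 1 y = 0"
    and curve_in: "y \<in> \<Omega> \<Longrightarrow> t \<in> {0..1} \<Longrightarrow> \<gamma> t y \<in> \<Omega>"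
    and curve_dist: "y \<in> \<Omega> \<Longrightarrow> t \<in> {0..1} \<Longrightarrow> lam * t \<le> bdist \<Omega> (\<gamma> t y)"
    and curve_lipschitz: "y \<in> \<Omega> \<Longrightarrow> K-lipschitz_on {0..1} (\<lambda>t. \<gamma> t y)"
begin

abbreviation d :: "'a \<Rightarrow> real" where "d \<equiv> bdist \<Omega>"

lemma frontier_nonempty: "frontier \<Omega> \<noteq> {}"
  using zero_in bounded_dom not_bounded_UNIV by (auto simp: frontier_eq_empty)

lemma bdist_le: "d x \<le> d y + dist x y"
  unfolding bdist_def by (rule infdist_triangle)

lemma bdist_nonneg: "0 \<le> d x"
  unfolding bdist_def by (rule infdist_nonneg)

lemma bdist_pos: "x \<in> \<Omega> \<Longrightarrow> 0 < d x"
  unfolding bdist_def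
  by (rule infdist_pos_not_in_closed) (use open_dom frontier_nonempty in \<open>auto simp: frontier_def interior_open\<close>)

text \<open>
  A segment that leaves \<open>\<Omega>\<close> meets the frontier.
\<close>
lemma in_dom_near:
  assumes "x \<in> \<Omega>" "dist x z < d x"
  shows "z \<in> \<Omega>"
proof (rule ccontr)
  assume "z \<notin> \<Omega>"
  then have "closed_segment x z \<inter> frontier \<Omega> \<noteq> {}"
    using assms(1) by (intro connected_Int_frontier) auto
  then obtain w where w: "w \<in> closed_segment x z" "w \<in> frontier \<Omega>" by auto
  have "d x \<le> dist x w" unfolding bdist_def using w(2) by (rule infdist_le)
  also have "\<dots> \<le> dist x z" using dist_in_closed_segment[OF w(1)] by (simp add: dist_commute)
  finally show False using assms(2) by simp
qed

lemma bdist_measurable [measurable]: "d \<in> borel_measurable borel"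
  unfolding bdist_def by (intro borel_measurable_continuous_onI continuous_intros)

lemma dom_measurable [measurable]: "\<Omega> \<in> sets borel"
  using open_dom by simp

lemma curve_dist_start:
  assumes "y \<in> \<Omega>" "0 \<le> t" "t \<le> 1"
  shows "dist y (\<gamma> t y) \<le> K * t"
  using lipschitz_onD[OF curve_lipschitz[OF assms(1)], of 0 t] assms start by simp

section \<open>Porosity of the boundary layer\<close>

definition collar :: "real \<Rightarrow> 'a \<Rightarrow> real \<Rightarrow> 'a set" where
  "collar \<tau> z R = {y \<in> \<Omega>. dist z y < R \<and> d y < \<tau>}"

lemma collar_borel [measurable]: "collar \<tau> z R \<in> sets borel"
  unfolding collar_def by measurable

lemma collar_fmeasurable: "collar \<tau> z R \<in> fmeasurable lborel"
  by (rule fmeasurableI2[of "ball z R"]) (auto simp: collar_def intro!: fmeasurableI emeasure_lborel_ball_finite)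

text \<open>
  The widths \<open>lam t / 2\<close> and \<open>3 K t\<close> of the two boundary layers compared in \<open>collar_step\<close> have ratio \<open>\<eta>\<close>,
  and \<open>\<kappa>\<close> is the factor by which the measure drops from one to the other.
\<close>
definition \<eta> :: real where "\<eta> = lam / (6 * K)"
definition \<kappa> :: real where "\<kappa> = 1 / (1 + \<eta> ^ DIM('a))"

lemma eta: "0 < \<eta>" "\<eta> < 1"
  using lam K by (auto simp: \<eta>_def divide_simps)

lemma kappa: "0 < \<kappa>" "\<kappa> < 1"
  using eta by (auto simp: \<kappa>_def divide_simps add_pos_pos)

text \<open>
  Put \<open>u = 3 K t\<close>. A point \<open>y\<close> of the layer of width \<open>t\<close> travels along its curve, within time \<open>t\<close>, to a
  ball of radius \<open>\<eta> u\<close> contained in \<open>ball y u\<close> and in the set \<open>A\<close> where \<open>\<eta> u \<le> d < u\<close>. Counting such pairs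
  in two ways, the measure of the layer is at most \<open>\<eta>\<^sup>-\<^sup>n\<close> times the measure of \<open>A\<close>. As \<open>A\<close> is the layer
  of width \<open>u\<close> without the one of width \<open>\<eta> u\<close>, the latter can be absorbed into the left-hand side,
  which leaves the factor \<open>\<kappa> < 1\<close>.
\<close>
lemma collar_step:
  assumes u: "0 < u" "u \<le> 3 * K"
  shows "measure lborel (collar (\<eta> * u) z R) \<le> \<kappa> * measure lborel (collar u z (R + u))"
proof -
  define t where "t = u / (3 * K)"
  have t: "0 < t" "t \<le> 1" and ut: "u = 3 * K * t" using u K by (auto simp: t_def)
  have eu: "\<eta> * u = lam * t / 2" using K by (simp add: \<eta>_def ut)
  define A where "A = collar u z (R + u) - collar (\<eta> * u) z (R + u)"
  have [measurable]: "A \<in> sets borel" unfolding A_def by measurable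
  have Afm: "A \<in> fmeasurable lborel"
    unfolding A_def by (intro fmeasurable_Diff collar_fmeasurable) auto
  let ?S = "collar t z R"
  let ?w = "unit_ball_vol (real DIM('a))"
  have hole: "ennreal (?w * (\<eta> * u) ^ DIM('a)) \<le> emeasure lborel (A \<inter> ball y u)" if y: "y \<in> ?S" for y
  proof -
    let ?x = "\<gamma> t y"
    have yO: "y \<in> \<Omega>" and dy: "d y < t" and zy: "dist z y < R" using y by (auto simp: collar_def)
    have x: "?x \<in> \<Omega>" "lam * t \<le> d ?x" "dist y ?x \<le> K * t"
      using yO t curve_in curve_dist curve_dist_start by auto
    have tK: "t \<le> K * t" "lam * t \<le> t" using t K lam by auto
    have "ball ?x (\<eta> * u) \<subseteq> A \<inter> ball y u"
    proof
      fix w assume "w \<in> ball ?x (\<eta> * u)"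
      then have w: "dist ?x w < lam * t / 2" by (simp add: eu)
      have lt: "lam * t > 0" using lam t by simp
      have wO: "w \<in> \<Omega>" using in_dom_near[OF x(1), of w] w x(2) lt by linarith
      have dw: "lam * t / 2 \<le> d w" using bdist_le[of ?x w] w x(2) by linarith
      have yw: "dist y w < 2 * K * t" using dist_triangle[of y w ?x] x(3) w tK t by linarith
      have "d w < u" using bdist_le[of w y] yw dy tK by (simp add: ut dist_commute)
      moreover have "dist z w < R + u" using dist_triangle[of z w y] zy yw tK t unfolding ut by linarith
      moreover have "dist y w < u" using yw tK t unfolding ut by linarith
      moreover have "\<not> d w < \<eta> * u" using dw by (simp add: eu)
      ultimately show "w \<in> A \<inter> ball y u" using wO by (simp add: A_def collar_def)
    qed
    then have "emeasure lborel (ball ?x (\<eta> * u)) \<le> emeasure lborel (A \<inter> ball y u)"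
      by (intro emeasure_mono) auto
    then show ?thesis using eta u by (simp add: emeasure_ball)
  qed
  have "ennreal (?w * (\<eta> * u) ^ DIM('a)) * emeasure lborel ?S
      = (\<integral>\<^sup>+y. indicator ?S y * ennreal (?w * (\<eta> * u) ^ DIM('a)) \<partial>lborel)"
    by (subst nn_integral_multc) (auto simp: mult.commute)
  also have "\<dots> \<le> (\<integral>\<^sup>+y. indicator ?S y * (\<integral>\<^sup>+x. indicator A x * indicator (ball y u) x \<partial>lborel) \<partial>lborel)"
  proof (intro nn_integral_mono)
    fix y
    show "indicator ?S y * ennreal (?w * (\<eta> * u) ^ DIM('a)) \<le> indicator ?S y * (\<integral>\<^sup>+x. indicator A x * indicator (ball y u) x \<partial>lborel)"
      using hole[of y] by (cases "y \<in> ?S") (simp_all flip: indicator_inter_arith)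
  qed
  also have "\<dots> = (\<integral>\<^sup>+x. indicator A x * (\<integral>\<^sup>+y. indicator ?S y * indicator (ball x u) y \<partial>lborel) \<partial>lborel)"
    by (rule nn_integral_ball_swap) auto
  also have "\<dots> \<le> (\<integral>\<^sup>+x. indicator A x * ennreal (?w * u ^ DIM('a)) \<partial>lborel)"
  proof (intro nn_integral_mono mult_left_mono)
    fix x
    have "(\<integral>\<^sup>+y. indicator ?S y * indicator (ball x u) y \<partial>lborel) \<le> (\<integral>\<^sup>+y. indicator (ball x u) y \<partial>lborel)"
      by (intro nn_integral_mono) (auto simp: indicator_def)
    also have "\<dots> = ennreal (?w * u ^ DIM('a))" using u by (simp add: emeasure_ball)
    finally show "(\<integral>\<^sup>+y. indicator ?S y * indicator (ball x u) y \<partial>lborel) \<le> ennreal (?w * u ^ DIM('a))" .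
  qed auto
  also have "\<dots> = ennreal (?w * u ^ DIM('a)) * emeasure lborel A"
    by (subst nn_integral_multc) (auto simp: mult.commute)
  finally have "?w * (\<eta> * u) ^ DIM('a) * measure lborel ?S \<le> ?w * u ^ DIM('a) * measure lborel A"
    using eta u Afm collar_fmeasurable[of t z R]
    by (simp add: emeasure_eq_measure2 flip: ennreal_mult)
  then have "?w * u ^ DIM('a) * (\<eta> ^ DIM('a) * measure lborel ?S) \<le> ?w * u ^ DIM('a) * measure lborel A"
    by (simp add: power_mult_distrib mult_ac)
  then have 1: "\<eta> ^ DIM('a) * measure lborel ?S \<le> measure lborel A"
    using u by (subst (asm) mult_le_cancel_left_pos) auto
  have "lam * t \<le> t" using t lam by simp
  then have "\<eta> * u \<le> t" using eu t by linarith
  moreover have "\<eta> * u \<le> u" using eta u by simp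
  ultimately have etu: "\<eta> * u \<le> t" "\<eta> * u \<le> u" by auto
  have 2: "measure lborel (collar (\<eta> * u) z R) \<le> measure lborel ?S"
    using etu by (intro measure_mono_fmeasurable collar_fmeasurable) (auto simp: collar_def)
  have 4: "\<eta> ^ DIM('a) * measure lborel (collar (\<eta> * u) z R) \<le> \<eta> ^ DIM('a) * measure lborel ?S"
    using 2 eta by (intro mult_left_mono) auto
  have 3: "measure lborel (collar (\<eta> * u) z R) \<le> measure lborel (collar (\<eta> * u) z (R + u))"
    using u by (intro measure_mono_fmeasurable collar_fmeasurable) (auto simp: collar_def)
  have "measure lborel A = measure lborel (collar u z (R + u)) - measure lborel (collar (\<eta> * u) z (R + u))"
    unfolding A_def using etu collar_fmeasurable
    by (intro measure_Diff) (auto simp: collar_def fmeasurable_def less_top)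
  then have "\<eta> ^ DIM('a) * measure lborel (collar (\<eta> * u) z R) \<le>
     measure lborel (collar u z (R + u)) - measure lborel (collar (\<eta> * u) z R)"
    using 1 3 4 by linarith
  then show ?thesis
    using eta by (simp add: \<kappa>_def field_simps add_pos_pos)
qed

text \<open>
  Iteration enlarges the ball at each step, but only by the width of the current layer; the
  enlargements form a geometric series, so the final radius stays comparable to the initial one.
\<close>
lemma collar_decay:
  assumes u: "0 < u" "u \<le> 3 * K"
  shows "measure lborel (collar (\<eta> ^ m * u) z R)
           \<le> \<kappa> ^ m * measure lborel (collar u z (R + u * (\<Sum>i<m. \<eta> ^ i)))"
proof (induction m arbitrary: R)
  case (Suc m)
  have e: "0 < \<eta> ^ m" "\<eta> ^ m \<le> 1" using eta by (auto simp: power_le_one)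
  have "measure lborel (collar (\<eta> ^ Suc m * u) z R) = measure lborel (collar (\<eta> * (\<eta> ^ m * u)) z R)"
    by (simp add: mult_ac)
  also have "\<dots> \<le> \<kappa> * measure lborel (collar (\<eta> ^ m * u) z (R + \<eta> ^ m * u))"
    using e u by (intro collar_step) (auto intro: order_trans[OF mult_left_le_one_le])
  also have "\<dots> \<le> \<kappa> * (\<kappa> ^ m * measure lborel (collar u z (R + \<eta> ^ m * u + u * (\<Sum>i<m. \<eta> ^ i))))"
    using Suc kappa by (intro mult_left_mono) auto
  also have "\<dots> = \<kappa> ^ Suc m * measure lborel (collar u z (R + u * (\<Sum>i<Suc m. \<eta> ^ i)))"
    by (simp add: algebra_simps)
  finally show ?case .
qed simp

lemma collar_measure_le:
  assumes r: "0 < r" "r \<le> 3 * K"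
  shows "emeasure lborel (collar (\<eta> ^ m * r) z r)
    \<le> ennreal (\<kappa> ^ m * (unit_ball_vol (real DIM('a)) * (1 + 1 / (1 - \<eta>)) ^ DIM('a) * r ^ DIM('a)))"
proof -
  let ?R = "r * (1 + 1 / (1 - \<eta>))"
  have "(\<Sum>i<m. \<eta> ^ i) \<le> 1 / (1 - \<eta>)"
    using eta by (simp add: sum_gp_strict divide_right_mono)
  then have R: "r + r * (\<Sum>i<m. \<eta> ^ i) \<le> ?R" using r mult_left_mono[of "\<Sum>i<m. \<eta> ^ i" "1 / (1 - \<eta>)" r] by (simp add: distrib_left)
  have R0: "?R \<ge> 0" using r eta by simp
  have "measure lborel (collar (\<eta> ^ m * r) z r) \<le> \<kappa> ^ m * measure lborel (collar r z (r + r * (\<Sum>i<m. \<eta> ^ i)))"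
    by (rule collar_decay[OF r])
  also have "\<dots> \<le> \<kappa> ^ m * measure lborel (ball z ?R)"
    using R kappa by (intro mult_left_mono measure_mono_fmeasurable)
       (auto simp: collar_def intro!: fmeasurableI emeasure_lborel_ball_finite)
  also have "measure lborel (ball z ?R) = unit_ball_vol (real DIM('a)) * ?R ^ DIM('a)"
    using R0 by (simp add: content_ball)
  finally have "measure lborel (collar (\<eta> ^ m * r) z r) \<le> \<kappa> ^ m * (unit_ball_vol (real DIM('a)) * ?R ^ DIM('a))" .
  also have "?R ^ DIM('a) = (1 + 1 / (1 - \<eta>)) ^ DIM('a) * r ^ DIM('a)"
    by (simp add: power_mult_distrib mult.commute)
  finally show ?thesis using collar_fmeasurable
    by (simp add: emeasure_eq_measure2 mult_ac ennreal_leI)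
qed

text \<open>
  The exponent is chosen such that \<open>\<eta>\<^sup>-\<^sup>\<epsilon> = \<kappa>\<^sup>-\<^sup>1\<^sup>/\<^sup>2\<close>: in the layer-by-layer sum the weight then grows more
  slowly than the measure of the layers decays.
\<close>
lemma porosity_integral:
  obtains \<epsilon> C where "\<epsilon> > 0" "C > 0"
    "\<And>z r. 0 < r \<Longrightarrow> r \<le> 3 * K \<Longrightarrow>
       (\<integral>\<^sup>+y. indicator \<Omega> y * indicator (ball z r) y * ennreal (max 1 (r / d y) powr \<epsilon>) \<partial>lborel)
         \<le> ennreal (C * r ^ DIM('a))"
proof -
  define \<beta> where "\<beta> = sqrt \<kappa>"
  have be: "0 < \<beta>" "\<beta> < 1" and be2: "\<beta> * \<beta> = \<kappa>" using kappa by (auto simp: \<beta>_def)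
  define \<epsilon> where "\<epsilon> = ln \<beta> / ln \<eta>"
  have ep: "\<epsilon> > 0" using eta be by (simp add: \<epsilon>_def divide_neg_neg)
  have eb: "\<eta> powr (- \<epsilon>) = 1 / \<beta>"
    using eta be by (simp add: \<epsilon>_def powr_def powr_minus exp_minus divide_simps)
  have ebm: "(1 / \<eta> ^ m) powr \<epsilon> = (1 / \<beta>) ^ m" for m
  proof -
    have "1 / \<eta> ^ m = \<eta> powr (- real m)"
      using eta by (simp add: powr_minus_divide powr_realpow)
    then have "(1 / \<eta> ^ m) powr \<epsilon> = (\<eta> powr (- \<epsilon>)) powr real m"
      by (simp add: powr_powr mult.commute)
    then show ?thesis using be by (simp add: eb powr_realpow)
  qed
  define c where "c = unit_ball_vol (real DIM('a)) * (1 + 1 / (1 - \<eta>)) ^ DIM('a)"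
  have c: "c > 0" using eta by (auto simp: c_def intro!: mult_pos_pos zero_less_power add_pos_pos)
  define C where "C = c + c / \<beta> * (1 / (1 - \<beta>))"
  have C: "C > 0" using c be by (auto simp: C_def intro!: add_pos_pos)
  show ?thesis
  proof (rule that[OF ep C])
    fix z r assume r: "0 < r" "r \<le> 3 * K"
    let ?w = "\<lambda>y. indicator \<Omega> y * indicator (ball z r) y * ennreal (max 1 (r / d y) powr \<epsilon>)"
    have pt: "?w y \<le> indicator (ball z r) y
        + (\<Sum>m. ennreal ((1 / \<beta>) ^ Suc m) * indicator (collar (\<eta> ^ m * r) z r) y)" for y
    proof (cases "y \<in> \<Omega> \<and> y \<in> ball z r \<and> d y < r")
      case True
      then have dy: "0 < d y" "d y < r" using bdist_pos by auto
      obtain m1 where "\<eta> ^ m1 < d y / r" using real_arch_pow_inv[of "d y / r" \<eta>] dy r eta by auto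
      then have ex: "\<exists>m. \<eta> ^ m * r \<le> d y" using r by (auto simp: pos_less_divide_eq intro: less_imp_le)
      define m where "m = (LEAST m. \<eta> ^ m * r \<le> d y)"
      have m: "\<eta> ^ m * r \<le> d y" unfolding m_def using ex by (rule LeastI_ex)
      have "m \<noteq> 0" using m dy by (intro notI) simp
      then obtain m' where m': "m = Suc m'" by (cases m) auto
      have "\<not> \<eta> ^ m' * r \<le> d y"
        using not_less_Least[of m' "\<lambda>m. \<eta> ^ m * r \<le> d y"] m' by (simp add: m_def)
      then have col: "y \<in> collar (\<eta> ^ m' * r) z r" using True by (auto simp: collar_def)
      have "r / d y \<le> 1 / \<eta> ^ m" using m dy eta by (simp add: divide_le_eq le_divide_eq mult.commute)
      moreover have "1 \<le> 1 / \<eta> ^ m" using eta by (simp add: power_le_one)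
      ultimately have "max 1 (r / d y) powr \<epsilon> \<le> (1 / \<eta> ^ m) powr \<epsilon>" using ep by (intro powr_mono2) auto
      also have "\<dots> = (1 / \<beta>) ^ Suc m'" by (simp only: m' ebm)
      finally have "?w y \<le> ennreal ((1 / \<beta>) ^ Suc m') * indicator (collar (\<eta> ^ m' * r) z r) y"
        using True col by (auto intro: ennreal_leI)
      also have "\<dots> \<le> (\<Sum>m. ennreal ((1 / \<beta>) ^ Suc m) * indicator (collar (\<eta> ^ m * r) z r) y)"
        by (rule ennreal_term_le_suminf)
      finally show ?thesis by (meson add_increasing zero_le)
    next
      case False
      then have "y \<in> \<Omega> \<Longrightarrow> y \<in> ball z r \<Longrightarrow> max 1 (r / d y) = 1" 
        using r bdist_pos[of y] by (simp add: max_def divide_le_eq)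
      then have "?w y \<le> indicator (ball z r) y" by (auto simp: indicator_def)
      then show ?thesis by (meson add_increasing2 zero_le)
    qed
    have "(\<integral>\<^sup>+y. ?w y \<partial>lborel) \<le> (\<integral>\<^sup>+y. indicator (ball z r) y
        + (\<Sum>m. ennreal ((1 / \<beta>) ^ Suc m) * indicator (collar (\<eta> ^ m * r) z r) y) \<partial>lborel)"
      by (intro nn_integral_mono pt)
    also have "\<dots> = emeasure lborel (ball z r)
        + (\<Sum>m. ennreal ((1 / \<beta>) ^ Suc m) * emeasure lborel (collar (\<eta> ^ m * r) z r))"
      by (rule nn_integral_indicator_plus_series) auto
    also have "\<dots> \<le> ennreal (c * r ^ DIM('a)) + (\<Sum>m. ennreal (c / \<beta> * r ^ DIM('a)) * ennreal (\<beta> ^ m))"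
    proof (intro add_mono suminf_le allI)
      have "(1::real) ^ DIM('a) \<le> (1 + 1 / (1 - \<eta>)) ^ DIM('a)"
        using eta by (intro power_mono) auto
      then have "unit_ball_vol (real DIM('a)) * 1 \<le> c" unfolding c_def by (intro mult_left_mono) auto
      then show "emeasure lborel (ball z r) \<le> ennreal (c * r ^ DIM('a))"
        using r by (simp add: emeasure_ball ennreal_leI mult_right_mono)
      fix m
      have "ennreal ((1 / \<beta>) ^ Suc m) * emeasure lborel (collar (\<eta> ^ m * r) z r)
          \<le> ennreal ((1 / \<beta>) ^ Suc m) * ennreal (\<kappa> ^ m * (c * r ^ DIM('a)))"
        using collar_measure_le[OF r, of m z] by (intro mult_left_mono) (auto simp: c_def)
      also have "\<dots> = ennreal ((1 / \<beta>) ^ Suc m * (\<kappa> ^ m * (c * r ^ DIM('a))))"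
        using be kappa c r by (subst ennreal_mult) auto
      also have "(1 / \<beta>) ^ Suc m * (\<kappa> ^ m * (c * r ^ DIM('a))) = c / \<beta> * r ^ DIM('a) * \<beta> ^ m"
        using be by (simp add: be2[symmetric] power_mult_distrib power_one_over)
      also have "ennreal \<dots> = ennreal (c / \<beta> * r ^ DIM('a)) * ennreal (\<beta> ^ m)"
        using be c r by (subst ennreal_mult) auto
      finally show "ennreal ((1 / \<beta>) ^ Suc m) * emeasure lborel (collar (\<eta> ^ m * r) z r)
          \<le> ennreal (c / \<beta> * r ^ DIM('a)) * ennreal (\<beta> ^ m)" .
    qed auto
    also have "(\<Sum>m. ennreal (c / \<beta> * r ^ DIM('a)) * ennreal (\<beta> ^ m)) = ennreal (c / \<beta> * r ^ DIM('a)) * ennreal (1 / (1 - \<beta>))"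
      using be by (subst ennreal_suminf_cmult, subst suminf_ennreal2) (auto simp: suminf_geometric summable_geometric)
    also have "ennreal (c * r ^ DIM('a)) + \<dots> = ennreal (C * r ^ DIM('a))"
      using be c r by (simp add: C_def algebra_simps flip: ennreal_mult ennreal_plus)
    finally show "(\<integral>\<^sup>+y. ?w y \<partial>lborel) \<le> ennreal (C * r ^ DIM('a))" .
  qed
qed

section \<open>The chain of balls along a curve\<close>

text \<open>
  During the time from \<open>\<theta> t\<close> to \<open>t\<close> a curve moves by at most \<open>K (1 - \<theta>) t = lam t / 16\<close>, the radius of
  its ball in the chain at time \<open>t\<close>.
\<close>
definition \<theta> :: real where "\<theta> = 1 - lam / (16 * K)"

lemma theta: "0 < \<theta>" "\<theta> < 1" "K * (1 - \<theta>) = lam / 16"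
  using lam K by (auto simp: \<theta>_def divide_simps)

lemma theta_pow: "0 < \<theta> ^ k" "\<theta> ^ k \<le> 1"
  using theta by (auto simp: power_le_one)

definition chain_ball :: "'a \<Rightarrow> nat \<Rightarrow> 'a set" where
  "chain_ball y k = ball (\<gamma> (\<theta> ^ k) y) (lam * \<theta> ^ k / 16)"

text \<open>
  The last claim uses \<open>d \<ge> lam t\<close> on the curve if \<open>d y\<close> is at most a multiple of \<open>t\<close>, and otherwise that
  \<open>x\<close> is within \<open>d y / 2\<close> of \<open>y\<close>.
\<close>
lemma chain_ball_position:
  assumes y: "y \<in> \<Omega>" and x: "x \<in> cball (\<gamma> (\<theta> ^ k) y) (lam * \<theta> ^ k / 16)"
  shows "x \<in> \<Omega>" "lam * \<theta> ^ k / 2 \<le> d x" "dist y x < 2 * K * \<theta> ^ k"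
    "lam / (8 * K) * max (\<theta> ^ k) (d y) \<le> d x"
proof -
  let ?t = "\<theta> ^ k" let ?c = "\<gamma> ?t y"
  have t: "0 < ?t" "?t \<le> 1" using theta_pow by auto
  have c: "?c \<in> \<Omega>" "lam * ?t \<le> d ?c" "dist y ?c \<le> K * ?t"
    using y t curve_in curve_dist curve_dist_start by auto
  have lt: "0 < lam * ?t" "lam * ?t \<le> ?t" "?t \<le> K * ?t" using lam t K by auto
  have x': "dist ?c x \<le> lam * ?t / 16" using x by simp
  show "x \<in> \<Omega>" by (rule in_dom_near[OF c(1)]) (use x' c lt in linarith)
  show dx: "lam * ?t / 2 \<le> d x" using bdist_le[of ?c x] x' c lt by linarith
  have "dist y x \<le> dist y ?c + dist ?c x" by (rule dist_triangle)
  then show yx: "dist y x < 2 * K * ?t" using c x' lt by linarith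
  have l8: "lam / (8 * K) \<le> lam / 2" "lam / (8 * K) \<le> 1 / 8" "lam / (8 * K) > 0" using lam K by (auto simp: divide_simps)
  have "lam / (8 * K) * ?t \<le> lam / 2 * ?t" using l8 t by (intro mult_right_mono) auto
  then have 1: "lam / (8 * K) * ?t \<le> d x" using dx by simp
  have 2: "lam / (8 * K) * d y \<le> d x"
  proof (cases "d y \<le> 4 * K * ?t")
    case True
    then have "lam / (8 * K) * d y \<le> lam / (8 * K) * (4 * K * ?t)" using l8 by (intro mult_left_mono) auto
    also have "\<dots> = lam * ?t / 2" using K by (simp add: field_simps)
    finally show ?thesis using dx by simp
  next
    case False
    then have "d y / 2 \<le> d x" using bdist_le[of y x] yx by linarith
    moreover have "lam / (8 * K) * d y \<le> 1 / 8 * d y" using l8 bdist_nonneg by (intro mult_right_mono) auto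
    ultimately show ?thesis using bdist_nonneg[of y] by linarith
  qed
  show "lam / (8 * K) * max ?t (d y) \<le> d x" using 1 2 by (simp add: max_def)
qed

text \<open>
  The constant matters: \<open>x\<close> has distance at least \<open>lam \<theta>\<^sup>k / 2\<close> to the boundary, so \<open>x\<close> and \<open>z\<close> are
  among the pairs at distance at most \<open>d x / 2\<close> over which the energy is taken.
\<close>
lemma chain_step_close:
  assumes y: "y \<in> \<Omega>" and x: "x \<in> chain_ball y k" and z: "z \<in> chain_ball y (Suc k)"
  shows "dist x z < 3 * lam * \<theta> ^ k / 16"
proof -
  let ?t = "\<theta> ^ k" let ?c = "\<gamma> ?t y" and ?c' = "\<gamma> (\<theta> ^ Suc k) y"
  have t: "0 < ?t" "?t \<le> 1" "0 < \<theta> ^ Suc k" "\<theta> ^ Suc k \<le> 1" 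
    using theta_pow[of k] theta_pow[of "Suc k"] by (simp_all del: power_Suc)
  have le: "\<theta> ^ Suc k \<le> ?t" using theta t by (simp add: mult_left_le_one_le)
  have "dist ?c ?c' \<le> K * dist ?t (\<theta> ^ Suc k)"
    using t by (intro lipschitz_onD[OF curve_lipschitz[OF y]]) auto
  also have "\<dots> = K * (1 - \<theta>) * ?t" using le by (simp add: dist_real_def algebra_simps)
  finally have cc: "dist ?c ?c' \<le> lam * ?t / 16" by (simp add: theta)
  have "lam * \<theta> ^ Suc k \<le> lam * ?t" using le lam by (intro mult_left_mono) auto
  then have "dist ?c' z < lam * ?t / 16" using z by (simp add: chain_ball_def)
  moreover have "dist x ?c < lam * ?t / 16" using x by (simp add: chain_ball_def dist_commute)
  moreover have "dist x z \<le> dist x ?c + dist ?c ?c' + dist ?c' z"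
    using dist_triangle[of x z ?c] dist_triangle[of ?c z ?c'] by linarith
  ultimately show ?thesis using cc by linarith
qed

lemma chain_ball_measure:
  "chain_ball y k \<in> fmeasurable lborel"
  "measure lborel (chain_ball y k) = unit_ball_vol (real DIM('a)) * (lam / 16) ^ DIM('a) * (\<theta> ^ k) ^ DIM('a)"
proof -
  show "chain_ball y k \<in> fmeasurable lborel"
    unfolding chain_ball_def by (intro fmeasurableI emeasure_lborel_ball_finite) simp
  show "measure lborel (chain_ball y k) = unit_ball_vol (real DIM('a)) * (lam / 16) ^ DIM('a) * (\<theta> ^ k) ^ DIM('a)"
    unfolding chain_ball_def using lam theta_pow[of k]
    by (simp add: content_ball power_mult_distrib power_divide)
qed

lemma chain_ball_measure_pos: "measure lborel (chain_ball y k) > 0"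
  unfolding chain_ball_measure(2) using lam theta by simp

lemma chain_ball_integrable:
  assumes f: "continuous_on \<Omega> f" and y: "y \<in> \<Omega>"
  shows "set_integrable lborel (chain_ball y k) (f :: 'a \<Rightarrow> real)"
proof -
  let ?B = "cball (\<gamma> (\<theta> ^ k) y) (lam * \<theta> ^ k / 16)"
  have "continuous_on ?B f"
    using f by (rule continuous_on_subset) (use chain_ball_position(1)[OF y] in blast)
  then have "set_integrable lborel ?B f"
    unfolding set_integrable_def by (intro borel_integrable_compact) auto
  then show ?thesis
    by (rule set_integrable_subset) (auto simp: chain_ball_def)
qed

lemma chain_avg_tendsto:
  assumes f: "continuous_on \<Omega> f" and y: "y \<in> \<Omega>"
  shows "(\<lambda>k. avg f (chain_ball y k)) \<longlonglongrightarrow> f y"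
proof (rule LIMSEQ_I)
  fix e :: real assume e: "e > 0"
  have "isCont f y" using f y open_dom by (simp add: continuous_on_eq_continuous_at)
  then obtain r where r: "r > 0" "\<And>x. dist x y < r \<Longrightarrow> dist (f x) (f y) < e / 4"
    using e unfolding continuous_at_eps_delta by (metis zero_less_divide_iff zero_less_numeral)
  have "(\<lambda>k. 2 * K * \<theta> ^ k) \<longlonglongrightarrow> 2 * K * 0"
    using theta by (intro tendsto_intros LIMSEQ_power_zero) auto
  then have "\<forall>\<^sub>F k in sequentially. 2 * K * \<theta> ^ k < r" using r by (intro order_tendstoD) auto
  then obtain N where N: "\<And>k. k \<ge> N \<Longrightarrow> 2 * K * \<theta> ^ k < r" by (auto simp: eventually_sequentially)
  have "norm (avg f (chain_ball y k) - f y) < e" if "k \<ge> N" for k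
  proof -
    let ?B = "chain_ball y k" let ?m = "measure lborel ?B"
    have m: "?m > 0" by (rule chain_ball_measure_pos)
    have fm: "?B \<in> fmeasurable lborel" by (rule chain_ball_measure)
    have "ennreal (\<bar>f y - avg f ?B\<bar> powr 1) \<le> ennreal (2 powr 1 / ?m) * (\<integral>\<^sup>+z\<in>?B. ennreal (\<bar>f y - f z\<bar> powr 1) \<partial>lborel)"
      by (rule avg_deviation_powr_le[OF chain_ball_integrable[OF f y] fm m]) simp
    also have "\<dots> \<le> ennreal (2 powr 1 / ?m) * (\<integral>\<^sup>+z. ennreal (e / 4) * indicator ?B z \<partial>lborel)"
    proof (intro mult_left_mono nn_integral_mono)
      fix z
      have "\<bar>f y - f z\<bar> \<le> e / 4" if "z \<in> ?B"
      proof -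
        have "dist y z < 2 * K * \<theta> ^ k" using that by (intro chain_ball_position(3)[OF y]) (auto simp: chain_ball_def)
        then show ?thesis using r(2)[of z] N[OF \<open>k \<ge> N\<close>] by (simp add: dist_commute dist_real_def)
      qed
      then show "ennreal (\<bar>f y - f z\<bar> powr 1) * indicator ?B z \<le> ennreal (e / 4) * indicator ?B z"
        by (auto simp: indicator_def intro: ennreal_leI)
    qed auto
    also have "\<dots> = ennreal (2 / ?m) * (ennreal (e / 4) * ennreal ?m)"
      using fm nn_integral_indicator[OF fmeasurableD[OF fm]]
      by (simp add: nn_integral_cmult emeasure_eq_measure2 fmeasurableD)
    also have "\<dots> = ennreal (e / 2)"
      using m e by (simp flip: ennreal_mult)
    finally have "\<bar>f y - avg f ?B\<bar> \<le> e / 2" using e by simp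
    then show ?thesis using e by (simp add: abs_minus_commute)
  qed
  then show "\<exists>no. \<forall>n\<ge>no. norm (avg f (chain_ball y n) - f y) < e" by blast
qed

section \<open>Oscillation at a single scale\<close>

lemma chain_ball_borel [measurable]: "chain_ball y k \<in> sets borel"
  unfolding chain_ball_def by simp

text \<open>
  The contribution of scale \<open>\<theta>\<^sup>k\<close> to the energy integrand, with the singular kernel frozen at the
  distance \<open>\<theta>\<^sup>k\<close> and cut off to pairs that can occur in two consecutive balls of a chain.
\<close>
definition osc :: "('a \<Rightarrow> real) \<Rightarrow> real \<Rightarrow> real \<Rightarrow> real \<Rightarrow> nat \<Rightarrow> 'a \<Rightarrow> 'a \<Rightarrow> ennreal" where
  "osc f p s b k x z =
     (if x \<in> \<Omega> \<and> lam * \<theta> ^ k / 2 \<le> d x \<and> dist x z < 3 * lam * \<theta> ^ k / 16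
      then ennreal (\<bar>f z - f x\<bar> powr p * (\<theta> ^ k) powr - (real DIM('a) + s * p) * d x powr b) else 0)"

definition osc_density where
  "osc_density f p s b k x = (\<integral>\<^sup>+z. osc f p s b k x z \<partial>lborel)"

definition local_energy where
  "local_energy f p s b k y = ennreal (1 / (\<theta> ^ k) ^ DIM('a)) *
     (\<integral>\<^sup>+x. osc_density f p s b k x * indicator (ball y (2 * K * \<theta> ^ k)) x \<partial>lborel)"

lemma osc_measurable_pair:
  assumes [measurable]: "f \<in> borel_measurable borel"
  shows "(\<lambda>(x, z). osc f p s b k x z) \<in> borel_measurable (lborel \<Otimes>\<^sub>M lborel)"
proof -
  have [measurable]: "Measurable.pred (borel \<Otimes>\<^sub>M borel) (\<lambda>q::'a \<times> 'a. dist (fst q) (snd q) < r)" for r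
  proof -
    have "{q::'a \<times> 'a. dist (fst q) (snd q) < r} \<in> sets (borel \<Otimes>\<^sub>M borel)"
      unfolding borel_prod by (intro borel_open open_Collect_less continuous_intros)
    then show ?thesis by (simp add: pred_def space_pair_measure)
  qed
  show ?thesis
    unfolding osc_def case_prod_beta' by measurable
qed

lemma osc_density_measurable [measurable]:
  assumes [measurable]: "f \<in> borel_measurable borel"
  shows "osc_density f p s b k \<in> borel_measurable borel"
proof -
  have "(\<lambda>x. osc_density f p s b k x) \<in> borel_measurable lborel"
    unfolding osc_density_def
    by (rule lborel.borel_measurable_nn_integral) (rule osc_measurable_pair, measurable)
  then show ?thesis by simp
qed

text \<open>
  Only scales above a multiple of \<open>\<bar>z - x\<bar>\<close> contribute, and the frozen kernels form a geometric series
  dominated by the smallest of these scales, which reproduces the singular kernel. Changing \<open>d x\<close>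
  into the minimum of the two distances costs a constant since they are comparable, and changing
  the exponent \<open>b\<close> into \<open>b'\<close> costs a power of the bound \<open>R\<close>.
\<close>
lemma osc_sum_le:
  assumes s: "s > 0" and p: "p \<ge> 1" and b: "0 \<le> b" "b' \<le> b" and R: "\<And>x. x \<in> \<Omega> \<Longrightarrow> d x \<le> R"
  obtains C where "C > 0" "\<And>f x z. (\<Sum>k. osc f p s b k x z) \<le> ennreal C *
     (indicator \<Omega> x * (indicator {z. norm (x - z) \<le> d x / 2} z *
       ennreal (\<bar>f z - f x\<bar> powr p / norm (z - x) powr (real DIM('a) + s * p) * min (d x) (d z) powr b')))"
proof -
  define m where "m = real DIM('a) + s * p"
  have m: "m > 0" using s p by (auto simp: m_def intro!: add_pos_pos mult_pos_pos)
  define a where "a = 3 * lam / 16"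
  have a: "a > 0" using lam by (simp add: a_def)
  have R0: "R > 0" using R[OF zero_in] bdist_pos[OF zero_in] by linarith
  \<comment> \<open>\<open>a\<close> from the cut-off, \<open>2 powr b\<close> from comparing the distances, the power of \<open>R\<close> from changing the exponent\<close>
  define C1 where "C1 = a powr m * 2 powr b * R powr (b - b')"
  define C where "C = C1 * (2 / (1 - \<theta> powr m))"
  have rho: "\<theta> powr m < 1" using theta powr_less_mono2[OF m, of \<theta> 1] by simp
  have C1: "C1 > 0" using a R0 by (simp add: C1_def)
  have C: "C > 0" using C1 rho by (simp add: C_def)
  show ?thesis
  proof (rule that[OF C])
    fix f x z
    let ?F = "\<bar>f z - f x\<bar> powr p / norm (z - x) powr m * min (d x) (d z) powr b'"
    show "(\<Sum>k. osc f p s b k x z) \<le> ennreal C *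
     (indicator \<Omega> x * (indicator {z. norm (x - z) \<le> d x / 2} z *
       ennreal (\<bar>f z - f x\<bar> powr p / norm (z - x) powr (real DIM('a) + s * p) * min (d x) (d z) powr b')))"
    proof (cases "x \<in> \<Omega> \<and> z \<noteq> x \<and> norm (x - z) \<le> d x / 2")
      case False
      have "osc f p s b k x z = 0" for k
      proof (cases "z = x")
        case True
        then show ?thesis by (simp add: osc_def)
      next
        case zx: False
        have "lam * \<theta> ^ k > 0" using lam theta by simp
        moreover have "x \<in> \<Omega> \<longrightarrow> norm (x - z) > d x / 2" using False zx by auto
        ultimately show ?thesis by (auto simp: osc_def dist_norm)
      qed
      then show ?thesis by simp
    next
      case True
      then have x: "x \<in> \<Omega>" and zx: "z \<noteq> x" and near: "norm (x - z) \<le> d x / 2" by auto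
      define \<tau> where "\<tau> = norm (z - x) / a"
      have tau: "\<tau> > 0" using zx a by (simp add: \<tau>_def)
      have dz: "d x / 2 \<le> d z" using bdist_le[of x z] near by (simp add: dist_norm)
      have dx: "d x > 0" using x by (rule bdist_pos)
      define w where "w = min (d x) (d z)"
      have w: "0 < w" "d x \<le> 2 * w" "w \<le> R" using dz dx R[OF x] by (auto simp: w_def min_def)
      have "d x powr b \<le> (2 * w) powr b" using w dx b by (intro powr_mono2) auto
      also have "\<dots> = 2 powr b * (w powr (b - b') * w powr b')" using w by (simp add: powr_mult flip: powr_add)
      also have "\<dots> \<le> 2 powr b * (R powr (b - b') * w powr b')"
        using w b by (intro mult_left_mono mult_right_mono powr_mono2) auto
      finally have db: "d x powr b \<le> 2 powr b * R powr (b - b') * w powr b'" by simp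
      have term_le: "osc f p s b k x z \<le> ennreal (C1 * ?F) * ennreal (min (\<theta>^k / \<tau>) (\<tau> / \<theta>^k) powr m)" for k
      proof (cases "dist x z < 3 * lam * \<theta> ^ k / 16")
        case True
        then have "\<tau> < \<theta> ^ k" using a lam by (simp add: \<tau>_def a_def dist_norm norm_minus_commute field_simps)
        then have mn: "min (\<theta>^k / \<tau>) (\<tau> / \<theta>^k) = \<tau> / \<theta> ^ k"
        proof -
          have "\<tau> / \<theta> ^ k \<le> 1" "1 \<le> \<theta> ^ k / \<tau>"
            using \<open>\<tau> < \<theta> ^ k\<close> tau theta_pow[of k] by auto
          then show ?thesis by simp
        qed
        have "(\<theta> ^ k) powr - m = (\<tau> / \<theta> ^ k) powr m * (a powr m / norm (z - x) powr m)"
          using tau a zx theta by (simp add: \<tau>_def powr_divide powr_mult powr_minus field_simps)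
        then have "\<bar>f z - f x\<bar> powr p * (\<theta> ^ k) powr - m * d x powr b
          \<le> \<bar>f z - f x\<bar> powr p * ((\<tau> / \<theta> ^ k) powr m * (a powr m / norm (z - x) powr m)) * (2 powr b * R powr (b - b') * w powr b')"
          using db by (intro mult_mono) auto
        also have "\<dots> = C1 * ?F * (min (\<theta>^k / \<tau>) (\<tau> / \<theta>^k) powr m)"
          unfolding mn C1_def w_def by (simp add: mult_ac)
        finally have "ennreal (\<bar>f z - f x\<bar> powr p * (\<theta> ^ k) powr - m * d x powr b) \<le> ennreal (C1 * ?F) * ennreal (min (\<theta>^k / \<tau>) (\<tau> / \<theta>^k) powr m)"
          using C1 by (subst ennreal_mult[symmetric]) (auto intro!: ennreal_leI mult_nonneg_nonneg)
        then show ?thesis by (simp add: osc_def m_def)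
      qed (simp add: osc_def)
      have "(\<Sum>k. osc f p s b k x z) \<le> (\<Sum>k. ennreal (C1 * ?F) * ennreal (min (\<theta>^k / \<tau>) (\<tau> / \<theta>^k) powr m))"
        by (intro suminf_le term_le) auto
      also have "\<dots> = ennreal (C1 * ?F) * (\<Sum>k. ennreal (min (\<theta>^k / \<tau>) (\<tau> / \<theta>^k) powr m))" by simp
      also have "\<dots> \<le> ennreal (C1 * ?F) * ennreal (2 / (1 - \<theta> powr m))"
        using theta tau m by (intro mult_left_mono two_sided_geometric_sum) auto
      also have "\<dots> = ennreal C * ennreal ?F"
        using C1 rho by (simp add: C_def mult_ac flip: ennreal_mult)
      finally show ?thesis using x near by (simp add: m_def)
    qed
  qed
qed

text \<open>
  Two applications of Jensen's inequality bound the jump by a double mean of \<open>\<bar>f z - f x\<bar>\<^sup>p\<close> over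
  consecutive balls. All pairs that occur there are counted by \<open>osc\<close>, and the weight
  \<open>d x powr b\<close> is removed by the lower bound for \<open>d x\<close> on the ball.
\<close>
lemma chain_jump_le:
  assumes s: "s > 0" and p: "p \<ge> 1" and b: "0 \<le> b"
  obtains C where "C > 0" "\<And>f y k. f \<in> borel_measurable borel \<Longrightarrow> continuous_on \<Omega> f \<Longrightarrow> y \<in> \<Omega> \<Longrightarrow>
     ennreal (\<bar>avg f (chain_ball y (Suc k)) - avg f (chain_ball y k)\<bar> powr p)
       \<le> ennreal (C * (\<theta> ^ k) powr (s * p) * max (\<theta> ^ k) (d y) powr - b) * local_energy f p s b k y"
proof -
  define m where "m = real DIM('a) + s * p"
  define v where "v = unit_ball_vol (real DIM('a)) * (lam / 16) ^ DIM('a)"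
  have v: "v > 0" using lam by (simp add: v_def)
  define c where "c = lam / (8 * K)"
  have c: "c > 0" using lam K by (simp add: c_def)
  define C where "C = 4 powr p / (v * v * \<theta> ^ DIM('a)) * c powr - b"
  have C: "C > 0" using v c theta by (simp add: C_def)
  show ?thesis
  proof (rule that[OF C])
    fix f :: "'a \<Rightarrow> real" and y k
    assume fm[measurable]: "f \<in> borel_measurable borel" and fc: "continuous_on \<Omega> f" and y: "y \<in> \<Omega>"
    let ?t = "\<theta> ^ k" and ?B = "chain_ball y k" and ?B' = "chain_ball y (Suc k)"
    let ?M = "max ?t (d y)"
    have t: "?t > 0" using theta by simp
    have M: "?M > 0" using t by simp
    define A where "A = ?t powr m * (c powr - b * ?M powr - b)"
    have "?t powr m > 0" "c powr - b > 0" "?M powr - b > 0" using t c M unfolding powr_gt_zero by linarith+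
    then have A: "A > 0" unfolding A_def by (intro mult_pos_pos)
    have pt: "ennreal (\<bar>f z - f x\<bar> powr p) \<le> ennreal A * osc f p s b k x z"
      if x: "x \<in> ?B" and z: "z \<in> ?B'" for x z
    proof -
      have xc: "x \<in> cball (\<gamma> ?t y) (lam * ?t / 16)" using x by (auto simp: chain_ball_def)
      note xf = chain_ball_position[OF y xc]
      have dx: "d x > 0" using bdist_pos[OF xf(1)] .
      have "0 < c * ?M" using c M by (rule mult_pos_pos)
      then have "(c * ?M) powr b \<le> d x powr b"
        using xf(4) b unfolding c_def by (intro powr_mono2) linarith+
      then have "1 \<le> (c * ?M) powr - b * d x powr b"
        using c M by (simp add: powr_minus field_simps)
      then have "1 \<le> c powr - b * ?M powr - b * d x powr b"
        using c M by (simp add: powr_mult)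
      then have "\<bar>f z - f x\<bar> powr p * 1 \<le> \<bar>f z - f x\<bar> powr p * (c powr - b * ?M powr - b * d x powr b)"
        by (intro mult_left_mono) auto
      also have "\<dots> = A * (\<bar>f z - f x\<bar> powr p * ?t powr - m * d x powr b)"
      proof -
        have tt: "?t powr m * ?t powr - m = 1" using theta by (simp flip: powr_add)
        have "A * (\<bar>f z - f x\<bar> powr p * ?t powr - m * d x powr b)
          = (?t powr m * ?t powr - m) * (\<bar>f z - f x\<bar> powr p * (c powr - b * ?M powr - b * d x powr b))"
          by (simp add: A_def mult_ac)
        then show ?thesis by (simp only: tt mult_1_left)
      qed
      finally have "ennreal (\<bar>f z - f x\<bar> powr p) \<le> ennreal A * ennreal (\<bar>f z - f x\<bar> powr p * ?t powr - m * d x powr b)"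
        using A by (subst ennreal_mult[symmetric]) (auto intro!: ennreal_leI mult_nonneg_nonneg)
      also have "ennreal (\<bar>f z - f x\<bar> powr p * ?t powr - m * d x powr b) = osc f p s b k x z"
        using xf chain_step_close[OF y x z] by (simp add: osc_def m_def)
      finally show ?thesis .
    qed
    let ?Q = "4 powr p / (measure lborel ?B * measure lborel ?B')"
    have "ennreal (\<bar>avg f ?B' - avg f ?B\<bar> powr p) \<le> ennreal ?Q *
       (\<integral>\<^sup>+x\<in>?B. (\<integral>\<^sup>+z\<in>?B'. ennreal (\<bar>f z - f x\<bar> powr p) \<partial>lborel) \<partial>lborel)"
      by (intro avg_diff_powr_le fm chain_ball_integrable fc y chain_ball_measure chain_ball_measure_pos p)
    also have "\<dots> \<le> ennreal ?Q * (\<integral>\<^sup>+x. ennreal A * (osc_density f p s b k x * indicator (ball y (2 * K * ?t)) x) \<partial>lborel)"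
    proof (intro mult_left_mono nn_integral_mono)
      fix x
      show "(\<integral>\<^sup>+z\<in>?B'. ennreal (\<bar>f z - f x\<bar> powr p) \<partial>lborel) * indicator ?B x
          \<le> ennreal A * (osc_density f p s b k x * indicator (ball y (2 * K * ?t)) x)"
      proof (cases "x \<in> ?B")
        case True
        have "(\<integral>\<^sup>+z\<in>?B'. ennreal (\<bar>f z - f x\<bar> powr p) \<partial>lborel) \<le> (\<integral>\<^sup>+z. ennreal A * osc f p s b k x z \<partial>lborel)"
          using pt[OF True] by (intro nn_integral_mono) (auto simp: indicator_def)
        also have "\<dots> = ennreal A * osc_density f p s b k x"
        proof -
          have "(\<lambda>z. osc f p s b k x z) \<in> borel_measurable lborel"
            using measurable_compose_Pair1[OF _ osc_measurable_pair[OF fm], of x p s b k] by simp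
          then show ?thesis unfolding osc_density_def by (rule nn_integral_cmult)
        qed
        finally have "(\<integral>\<^sup>+z\<in>?B'. ennreal (\<bar>f z - f x\<bar> powr p) \<partial>lborel)
          \<le> ennreal A * osc_density f p s b k x" .
        moreover have "x \<in> ball y (2 * K * ?t)"
          using True by (auto intro!: chain_ball_position(3)[OF y] simp: chain_ball_def)
        ultimately show ?thesis using True by simp
      qed simp
    qed auto
    also have "\<dots> = ennreal ?Q * (ennreal A * (\<integral>\<^sup>+x. osc_density f p s b k x * indicator (ball y (2 * K * ?t)) x \<partial>lborel))"
    proof -
      note osc_density_measurable[OF fm, measurable]
      have [measurable]: "ball y (2 * K * ?t) \<in> sets borel" by simp
      have "(\<lambda>x. osc_density f p s b k x * indicator (ball y (2 * K * ?t)) x) \<in> borel_measurable lborel"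
        by measurable
      then show ?thesis by (simp only: nn_integral_cmult)
    qed
    also have "\<dots> = ennreal (C * ?t powr (s * p) * ?M powr - b) * local_energy f p s b k y"
    proof -
      have Qe: "?Q = 4 powr p / (v * v * \<theta> ^ DIM('a)) / (?t ^ DIM('a) * ?t ^ DIM('a))"
        by (simp add: chain_ball_measure(2) v_def power_mult_distrib mult_ac)
      have tm: "?t powr m = ?t ^ DIM('a) * ?t powr (s * p)"
        using t by (simp add: m_def powr_add powr_realpow)
      have "?Q * A = C * ?t powr (s * p) * ?M powr - b * (1 / ?t ^ DIM('a))"
      proof -
        have "w / (T * T) * (T * S * (x * M)) = w * x * S * M * (1 / T)" if "T \<noteq> 0" for w T S x M :: real
          using that by (simp add: field_simps)
        moreover have "?t ^ DIM('a) \<noteq> 0" using theta by simp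
        ultimately show ?thesis unfolding Qe A_def tm C_def by blast
      qed
      moreover have "ennreal (?Q * A) = ennreal ?Q * ennreal A" using A by (intro ennreal_mult) auto
      moreover have "ennreal (C * ?t powr (s * p) * ?M powr - b * (1 / ?t ^ DIM('a)))
         = ennreal (C * ?t powr (s * p) * ?M powr - b) * ennreal (1 / ?t ^ DIM('a))"
        using C t by (intro ennreal_mult) auto
      ultimately show ?thesis unfolding local_energy_def by (simp only: mult.assoc[symmetric])
    qed
    finally show "ennreal (\<bar>avg f ?B' - avg f ?B\<bar> powr p)
       \<le> ennreal (C * ?t powr (s * p) * ?M powr - b) * local_energy f p s b k y" .
  qed
qed

section \<open>Weighted sums of local energies\<close>

lemma local_energy_measurable [measurable]:
  assumes [measurable]: "f \<in> borel_measurable borel"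
  shows "local_energy f p s b k \<in> borel_measurable borel"
proof -
  note osc_density_measurable[OF assms, measurable]
  have "{q::'a \<times> 'a. dist (fst q) (snd q) < r} \<in> sets (borel \<Otimes>\<^sub>M borel)" for r
    unfolding borel_prod by (intro borel_open open_Collect_less continuous_intros)
  then have [measurable]: "Measurable.pred (borel \<Otimes>\<^sub>M borel) (\<lambda>q::'a \<times> 'a. dist (fst q) (snd q) < r)" for r
    by (simp add: pred_def space_pair_measure)
  have "(\<lambda>y. \<integral>\<^sup>+x. (if dist (fst (y, x)) (snd (y, x)) < 2 * K * \<theta> ^ k then osc_density f p s b k x else 0) \<partial>lborel)
      \<in> borel_measurable borel"
    by (rule lborel.borel_measurable_nn_integral) measurable
  moreover have "local_energy f p s b k = (\<lambda>y. ennreal (1 / (\<theta> ^ k) ^ DIM('a)) *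
     (\<integral>\<^sup>+x. (if dist (fst (y, x)) (snd (y, x)) < 2 * K * \<theta> ^ k then osc_density f p s b k x else 0) \<partial>lborel))"
    unfolding local_energy_def
    by (intro ext arg_cong2[where f="(*)"] refl nn_integral_cong) (auto simp: indicator_def)
  ultimately show ?thesis by simp
qed

definition weighted_energy where
  "weighted_energy \<epsilon> f p s b y = (\<Sum>k. ennreal (max 1 (\<theta> ^ k / d y) powr \<epsilon>) * local_energy f p s b k y)"

text \<open>
  After exchanging the order of integration the weight is integrated over a ball about \<open>x\<close> of radius
  comparable to \<open>\<theta>\<^sup>k\<close>, where porosity bounds its mean by a constant.
\<close>
lemma weighted_energy_integral_le:
  obtains \<epsilon> C where "\<epsilon> > 0" "C > 0"
    "\<And>f p s b. f \<in> borel_measurable borel \<Longrightarrow>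
       (\<integral>\<^sup>+y\<in>\<Omega>. weighted_energy \<epsilon> f p s b y \<partial>lborel)
         \<le> ennreal C * (\<Sum>k. \<integral>\<^sup>+x. osc_density f p s b k x \<partial>lborel)"
proof -
  obtain \<epsilon> C0 where ep: "\<epsilon> > 0" and C0: "C0 > 0" and por:
    "\<And>z r. 0 < r \<Longrightarrow> r \<le> 3 * K \<Longrightarrow>
       (\<integral>\<^sup>+y. indicator \<Omega> y * indicator (ball z r) y * ennreal (max 1 (r / d y) powr \<epsilon>) \<partial>lborel)
         \<le> ennreal (C0 * r ^ DIM('a))"
    using porosity_integral by blast
  define C where "C = C0 * (2 * K) ^ DIM('a)"
  have C: "C > 0" using C0 K by (simp add: C_def)
  show ?thesis
  proof (rule that[OF ep C])
    fix f :: "'a \<Rightarrow> real" and p s b :: real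
    assume fm[measurable]: "f \<in> borel_measurable borel"
    note osc_density_measurable[OF fm, measurable]
    note local_energy_measurable[OF fm, measurable]
    let ?W = "\<lambda>k y. ennreal (max 1 (\<theta> ^ k / d y) powr \<epsilon>)"
    let ?O = "osc_density f p s b"
    have one: "(\<integral>\<^sup>+y. (?W k y * local_energy f p s b k y) * indicator \<Omega> y \<partial>lborel) \<le> ennreal C * (\<integral>\<^sup>+x. ?O k x \<partial>lborel)" for k
    proof -
      let ?t = "\<theta> ^ k" let ?r = "2 * K * ?t"
      have t: "0 < ?t" "?t \<le> 1" by (rule theta_pow)+
      have r: "0 < ?r" "?r \<le> 3 * K" "?t \<le> ?r" using t K mult_left_mono[of ?t 1 "2 * K"] mult_right_mono[of 1 "2 * K" ?t] by auto
      have "(\<integral>\<^sup>+y. (?W k y * local_energy f p s b k y) * indicator \<Omega> y \<partial>lborel)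
        = (\<integral>\<^sup>+y. ennreal (1 / ?t ^ DIM('a)) * ((?W k y * indicator \<Omega> y) * (\<integral>\<^sup>+x. ?O k x * indicator (ball y ?r) x \<partial>lborel)) \<partial>lborel)"
        by (intro nn_integral_cong) (simp add: local_energy_def mult_ac)
      also have "\<dots> = ennreal (1 / ?t ^ DIM('a)) * (\<integral>\<^sup>+y. (?W k y * indicator \<Omega> y) * (\<integral>\<^sup>+x. ?O k x * indicator (ball y ?r) x \<partial>lborel) \<partial>lborel)"
      proof (rule nn_integral_cmult)
        have "(\<lambda>y. ennreal (?t ^ DIM('a)) * local_energy f p s b k y) \<in> borel_measurable lborel" by measurable
        moreover have "(\<lambda>y. ennreal (?t ^ DIM('a)) * local_energy f p s b k y) = (\<lambda>y. \<integral>\<^sup>+x. ?O k x * indicator (ball y ?r) x \<partial>lborel)"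
        proof
          fix y
          have "ennreal (?t ^ DIM('a)) * ennreal (1 / ?t ^ DIM('a)) = 1"
            using theta by (simp flip: ennreal_mult)
          then show "ennreal (?t ^ DIM('a)) * local_energy f p s b k y = (\<integral>\<^sup>+x. ?O k x * indicator (ball y ?r) x \<partial>lborel)"
            unfolding local_energy_def by (simp only: mult.assoc[symmetric] mult_1)
        qed
        ultimately have [measurable]: "(\<lambda>y. \<integral>\<^sup>+x. ?O k x * indicator (ball y ?r) x \<partial>lborel) \<in> borel_measurable lborel" by simp
        show "(\<lambda>y. (?W k y * indicator \<Omega> y) * (\<integral>\<^sup>+x. ?O k x * indicator (ball y ?r) x \<partial>lborel)) \<in> borel_measurable lborel"
          by measurable
      qed
      finally have split: "(\<integral>\<^sup>+y. (?W k y * local_energy f p s b k y) * indicator \<Omega> y \<partial>lborel)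
        = ennreal (1 / ?t ^ DIM('a)) * (\<integral>\<^sup>+y. (?W k y * indicator \<Omega> y) * (\<integral>\<^sup>+x. ?O k x * indicator (ball y ?r) x \<partial>lborel) \<partial>lborel)" .
      have "(\<integral>\<^sup>+y. (?W k y * indicator \<Omega> y) * (\<integral>\<^sup>+x. ?O k x * indicator (ball y ?r) x \<partial>lborel) \<partial>lborel)
         = (\<integral>\<^sup>+x. ?O k x * (\<integral>\<^sup>+y. (?W k y * indicator \<Omega> y) * indicator (ball x ?r) y \<partial>lborel) \<partial>lborel)"
        by (rule nn_integral_ball_swap) measurable
      also have "\<dots> \<le> (\<integral>\<^sup>+x. ?O k x * ennreal (C0 * ?r ^ DIM('a)) \<partial>lborel)"
      proof (intro nn_integral_mono mult_left_mono)
        fix x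
        have "(\<integral>\<^sup>+y. (?W k y * indicator \<Omega> y) * indicator (ball x ?r) y \<partial>lborel)
           \<le> (\<integral>\<^sup>+y. indicator \<Omega> y * indicator (ball x ?r) y * ennreal (max 1 (?r / d y) powr \<epsilon>) \<partial>lborel)"
        proof (intro nn_integral_mono)
          fix y
          have "max 1 (?t / d y) powr \<epsilon> \<le> max 1 (?r / d y) powr \<epsilon>"
            using ep r bdist_nonneg[of y] by (intro powr_mono2 max.mono divide_right_mono) auto
          then show "(?W k y * indicator \<Omega> y) * indicator (ball x ?r) y \<le> indicator \<Omega> y * indicator (ball x ?r) y * ennreal (max 1 (?r / d y) powr \<epsilon>)"
            by (auto simp: indicator_def intro: ennreal_leI)
        qed
        also have "\<dots> \<le> ennreal (C0 * ?r ^ DIM('a))" by (rule por[OF r(1,2)])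
        finally show "(\<integral>\<^sup>+y. (?W k y * indicator \<Omega> y) * indicator (ball x ?r) y \<partial>lborel) \<le> ennreal (C0 * ?r ^ DIM('a))" .
      qed auto
      also have "\<dots> = (\<integral>\<^sup>+x. ?O k x \<partial>lborel) * ennreal (C0 * ?r ^ DIM('a))"
        by (rule nn_integral_multc) simp
      finally have swap: "(\<integral>\<^sup>+y. (?W k y * indicator \<Omega> y) * (\<integral>\<^sup>+x. ?O k x * indicator (ball y ?r) x \<partial>lborel) \<partial>lborel)
        \<le> (\<integral>\<^sup>+x. ?O k x \<partial>lborel) * ennreal (C0 * ?r ^ DIM('a))" .
      have cc: "ennreal (1 / ?t ^ DIM('a)) * ennreal (C0 * ?r ^ DIM('a)) = ennreal C"
        using theta C0 K by (simp add: C_def power_mult_distrib flip: ennreal_mult)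
      have "ennreal (1 / ?t ^ DIM('a)) * ((\<integral>\<^sup>+x. ?O k x \<partial>lborel) * ennreal (C0 * ?r ^ DIM('a)))
         = ennreal C * (\<integral>\<^sup>+x. ?O k x \<partial>lborel)"
        unfolding cc[symmetric] by (simp only: mult_ac)
      then show ?thesis
        using mult_left_mono[OF swap, of "ennreal (1 / ?t ^ DIM('a))"] by (simp only: split) simp
    qed
    have "(\<integral>\<^sup>+y\<in>\<Omega>. weighted_energy \<epsilon> f p s b y \<partial>lborel)
       = (\<integral>\<^sup>+y. (\<Sum>k. (?W k y * local_energy f p s b k y) * indicator \<Omega> y) \<partial>lborel)"
      unfolding weighted_energy_def by simp
    also have "\<dots> = (\<Sum>k. \<integral>\<^sup>+y. (?W k y * local_energy f p s b k y) * indicator \<Omega> y \<partial>lborel)"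
      by (rule nn_integral_suminf) measurable
    also have "\<dots> \<le> (\<Sum>k. ennreal C * (\<integral>\<^sup>+x. ?O k x \<partial>lborel))"
      by (intro suminf_le one) auto
    finally show "(\<integral>\<^sup>+y\<in>\<Omega>. weighted_energy \<epsilon> f p s b y \<partial>lborel) \<le> ennreal C * (\<Sum>k. \<integral>\<^sup>+x. ?O k x \<partial>lborel)"
      by simp
  qed
qed

text \<open>
  The constant \<open>E\<close> is only required to dominate the energy, so that it can be kept positive; the
  exponent \<open>q / p - 1\<close> of \<open>E\<close> below may be 0. The hypothesis on \<open>b\<close> is the scale invariance of the
  inequality.
\<close>
lemma deviation_integral_le:
  assumes s: "s > 0" and p: "p \<ge> 1" and q: "p \<le> q" and a: "a \<ge> 0"
    and sub: "real DIM('a) / p - real DIM('a) / q \<le> s"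
    and b: "b / p = a / q + (s - real DIM('a) / p + real DIM('a) / q)"
  obtains C where "C > 0"
    "\<And>f E. f \<in> borel_measurable borel \<Longrightarrow> continuous_on \<Omega> f \<Longrightarrow> E > 0 \<Longrightarrow>
       (\<Sum>k. \<integral>\<^sup>+x. osc_density f p s b k x \<partial>lborel) \<le> ennreal E \<Longrightarrow>
       (\<integral>\<^sup>+y\<in>\<Omega>. ennreal (\<bar>f y - avg f (ball 0 (lam / 16))\<bar> powr q * d y powr a) \<partial>lborel)
         \<le> ennreal (C * E powr (q / p))"
proof -
  let ?n = "real DIM('a)"
  have p0: "p > 0" and q0: "q > 0" using p q by auto
  have b0: "b \<ge> 0"
  proof -
    have "b / p \<ge> 0" using a q0 sub b by simp
    then show ?thesis using p0 by (simp add: zero_le_divide_iff)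
  qed
  obtain \<epsilon> C1 where ep: "\<epsilon> > 0" and C1: "C1 > 0" and int_le:
    "\<And>f p s b. f \<in> borel_measurable borel \<Longrightarrow>
       (\<integral>\<^sup>+y\<in>\<Omega>. weighted_energy \<epsilon> f p s b y \<partial>lborel)
         \<le> ennreal C1 * (\<Sum>k. \<integral>\<^sup>+x. osc_density f p s b k x \<partial>lborel)"
    using weighted_energy_integral_le by blast
  obtain C2 where C2: "C2 > 0" and jump: "\<And>f y k. f \<in> borel_measurable borel \<Longrightarrow> continuous_on \<Omega> f \<Longrightarrow> y \<in> \<Omega> \<Longrightarrow>
     ennreal (\<bar>avg f (chain_ball y (Suc k)) - avg f (chain_ball y k)\<bar> powr p)
       \<le> ennreal (C2 * (\<theta> ^ k) powr (s * p) * max (\<theta> ^ k) (d y) powr - b) * local_energy f p s b k y"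
    using chain_jump_le[OF s p b0] by blast
  have n0: "?n > 0" by simp
  obtain C3 where C3: "C3 > 0" and sum_le:
    "\<And>D Q E (P :: nat \<Rightarrow> real). D > 0 \<Longrightarrow> Q \<ge> 0 \<Longrightarrow> E > 0 \<Longrightarrow> (\<And>k. P k \<ge> 0) \<Longrightarrow>
       (\<And>k. max 1 (\<theta> ^ k / D) powr \<epsilon> * P k \<le> Q) \<Longrightarrow> (\<And>k. (\<theta> ^ k) powr ?n * P k \<le> E) \<Longrightarrow>
       (\<Sum>k. ennreal ((\<theta> ^ k) powr s * max (\<theta> ^ k) D powr (- (b / p)) * P k powr (1 / p)))
         \<le> ennreal (C3 * (D powr (- (a / q)) * Q powr (1 / q) * E powr (1 / p - 1 / q)))"
    using scale_sum_le[OF theta(1,2) n0 s p0 q a ep sub b] by blast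
  define C4 where "C4 = (C2 powr (1 / p) * C3) powr q"
  have C4: "C4 > 0" using C2 C3 by (simp add: C4_def)
  define C where "C = C4 * C1"
  have C: "C > 0" using C1 C4 by (simp add: C_def)
  show ?thesis
  proof (rule that[OF C])
    fix f :: "'a \<Rightarrow> real" and E :: real
    assume fm: "f \<in> borel_measurable borel" and fc: "continuous_on \<Omega> f" and E: "E > 0"
      and total: "(\<Sum>k. \<integral>\<^sup>+x. osc_density f p s b k x \<partial>lborel) \<le> ennreal E"
    note osc_density_measurable[OF fm, measurable]
    note local_energy_measurable[OF fm, measurable]
    let ?c = "avg f (ball 0 (lam / 16))"
    let ?Q = "weighted_energy \<epsilon> f p s b"
    have point: "ennreal (\<bar>f y - ?c\<bar> powr q * d y powr a) \<le> ennreal (C4 * E powr (q / p - 1)) * ?Q y"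
      if y: "y \<in> \<Omega>" for y
    \<comment> \<open>an infinite weighted energy, possible on a null set, makes the pointwise bound trivial\<close>
    proof (cases "?Q y = \<infinity>")
      case True
      have "ennreal (C4 * E powr (q / p - 1)) \<noteq> 0" using C4 E by simp
      then show ?thesis unfolding True by (simp add: ennreal_mult_top)
    next
      case False
      then obtain Q where Q: "Q \<ge> 0" "?Q y = ennreal Q" by (cases "?Q y") auto
      have dy: "d y > 0" using bdist_pos[OF y] .
      have WP: "ennreal (max 1 (\<theta> ^ k / d y) powr \<epsilon>) * local_energy f p s b k y \<le> ennreal Q" for k
        unfolding Q(2)[symmetric] weighted_energy_def
        by (rule ennreal_term_le_suminf[of "\<lambda>k. ennreal (max 1 (\<theta> ^ k / d y) powr \<epsilon>) * local_energy f p s b k y"])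
      have PQ1: "local_energy f p s b k y \<le> ennreal Q" for k
      proof -
        have "1 \<le> max 1 (\<theta> ^ k / d y) powr \<epsilon>" using ep by (intro ge_one_powr_ge_zero) auto
        then have "1 * local_energy f p s b k y \<le> ennreal (max 1 (\<theta> ^ k / d y) powr \<epsilon>) * local_energy f p s b k y"
          by (intro mult_right_mono) auto
        then have "local_energy f p s b k y \<le> ennreal (max 1 (\<theta> ^ k / d y) powr \<epsilon>) * local_energy f p s b k y"
          by (simp only: mult_1)
        from this WP[of k] show ?thesis by (rule order_trans)
      qed
      define P where "P k = enn2real (local_energy f p s b k y)" for k
      have P: "local_energy f p s b k y = ennreal (P k)" for k
        using PQ1[of k] unfolding P_def by (simp add: order_le_less_trans[OF _ ennreal_less_top])
      have P0: "P k \<ge> 0" for k by (simp add: P_def)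
      have PQ: "max 1 (\<theta> ^ k / d y) powr \<epsilon> * P k \<le> Q" for k
        using WP[of k] P0[of k] Q by (simp add: P flip: ennreal_mult)
      have PE: "(\<theta> ^ k) powr ?n * P k \<le> E" for k
      proof -
        have t: "\<theta> ^ k > 0" by (rule theta_pow)
        have tt: "ennreal ((\<theta> ^ k) ^ DIM('a)) * ennreal (1 / (\<theta> ^ k) ^ DIM('a)) = 1"
          using theta by (simp flip: ennreal_mult)
        have "ennreal ((\<theta> ^ k) ^ DIM('a)) * local_energy f p s b k y
           = (\<integral>\<^sup>+x. osc_density f p s b k x * indicator (ball y (2 * K * \<theta> ^ k)) x \<partial>lborel)"
          unfolding local_energy_def by (simp only: mult.assoc[symmetric] tt mult_1)
        also have "\<dots> \<le> (\<integral>\<^sup>+x. osc_density f p s b k x \<partial>lborel)"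
          by (intro nn_integral_mono) (auto simp: indicator_def)
        also have "\<dots> \<le> (\<Sum>k. \<integral>\<^sup>+x. osc_density f p s b k x \<partial>lborel)"
          by (rule ennreal_term_le_suminf)
        also note total
        finally have "(\<theta> ^ k) ^ DIM('a) * P k \<le> E"
          using t P0[of k] E by (simp add: P flip: ennreal_mult)
        then show ?thesis using t by (simp add: powr_realpow)
      qed
      let ?T = "\<lambda>k. (\<theta> ^ k) powr s * max (\<theta> ^ k) (d y) powr (- (b / p)) * P k powr (1 / p)"
      have J: "\<bar>avg f (chain_ball y (Suc k)) - avg f (chain_ball y k)\<bar> \<le> C2 powr (1 / p) * ?T k" for k
      proof -
        let ?M = "max (\<theta> ^ k) (d y)"
        let ?j = "\<bar>avg f (chain_ball y (Suc k)) - avg f (chain_ball y k)\<bar>"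
        have "ennreal (?j powr p) \<le> ennreal (C2 * (\<theta> ^ k) powr (s * p) * ?M powr - b) * ennreal (P k)"
          using jump[OF fm fc y, of k] by (simp only: P)
        then have "?j powr p \<le> C2 * (\<theta> ^ k) powr (s * p) * ?M powr - b * P k"
          using P0[of k] C2 by (simp flip: ennreal_mult)
        then have "(?j powr p) powr (1 / p) \<le> (C2 * (\<theta> ^ k) powr (s * p) * ?M powr - b * P k) powr (1 / p)"
          using p0 by (intro powr_mono2) auto
        moreover have "(?j powr p) powr (1 / p) = ?j" using p0 by (simp add: powr_powr)
        moreover have "(C2 * (\<theta> ^ k) powr (s * p) * ?M powr - b * P k) powr (1 / p) = C2 powr (1 / p) * ?T k"
          using p0 C2 P0[of k] dy by (simp add: powr_mult powr_powr mult.assoc)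
        ultimately show ?thesis by simp
      qed
      have zero: "chain_ball y 0 = ball 0 (lam / 16)" by (simp add: chain_ball_def finish[OF y])
      have "ennreal \<bar>f y - ?c\<bar> \<le> (\<Sum>k. ennreal \<bar>avg f (chain_ball y (Suc k)) - avg f (chain_ball y k)\<bar>)"
        using ennreal_abs_limit_le_suminf[OF chain_avg_tendsto[OF fc y]] by (simp add: zero)
      also have "\<dots> \<le> (\<Sum>k. ennreal (C2 powr (1 / p)) * ennreal (?T k))"
      proof (intro suminf_le allI)
        fix k
        have "ennreal \<bar>avg f (chain_ball y (Suc k)) - avg f (chain_ball y k)\<bar> \<le> ennreal (C2 powr (1 / p) * ?T k)"
          by (rule ennreal_leI[OF J])
        then show "ennreal \<bar>avg f (chain_ball y (Suc k)) - avg f (chain_ball y k)\<bar> \<le> ennreal (C2 powr (1 / p)) * ennreal (?T k)"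
          by (subst ennreal_mult[symmetric]) auto
      qed auto
      also have "\<dots> = ennreal (C2 powr (1 / p)) * (\<Sum>k. ennreal (?T k))" by simp
      also have "\<dots> \<le> ennreal (C2 powr (1 / p)) * ennreal (C3 * (d y powr (- (a / q)) * Q powr (1 / q) * E powr (1 / p - 1 / q)))"
        by (intro mult_left_mono sum_le dy Q(1) E P0 PQ PE) auto
      also have "\<dots> = ennreal (C2 powr (1 / p) * C3 * (d y powr (- (a / q)) * Q powr (1 / q) * E powr (1 / p - 1 / q)))"
        using C3 by (subst ennreal_mult[symmetric]) (auto simp: mult.assoc)
      finally have "\<bar>f y - ?c\<bar> \<le> C2 powr (1 / p) * C3 * (d y powr (- (a / q)) * Q powr (1 / q) * E powr (1 / p - 1 / q))"
        using C3 by (subst (asm) ennreal_le_iff) auto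
      then have "\<bar>f y - ?c\<bar> powr q \<le> (C2 powr (1 / p) * C3 * (d y powr (- (a / q)) * Q powr (1 / q) * E powr (1 / p - 1 / q))) powr q"
        using q0 by (intro powr_mono2) auto
      also have "\<dots> = C4 * (d y powr - a * Q * E powr (q / p - 1))"
        using q0 C2 C3 Q E dy by (simp add: C4_def powr_mult powr_powr left_diff_distrib)
      finally have "\<bar>f y - ?c\<bar> powr q * d y powr a \<le> C4 * (d y powr - a * Q * E powr (q / p - 1)) * d y powr a"
        by (intro mult_right_mono) auto
      also have "\<dots> = C4 * E powr (q / p - 1) * Q" using dy by (simp add: powr_minus)
      finally have "ennreal (\<bar>f y - ?c\<bar> powr q * d y powr a) \<le> ennreal (C4 * E powr (q / p - 1) * Q)"
        by (rule ennreal_leI)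
      then show ?thesis using C4 Q by (simp add: ennreal_mult)
    qed
    have "(\<integral>\<^sup>+y\<in>\<Omega>. ennreal (\<bar>f y - ?c\<bar> powr q * d y powr a) \<partial>lborel)
       \<le> (\<integral>\<^sup>+y. ennreal (C4 * E powr (q / p - 1)) * (?Q y * indicator \<Omega> y) \<partial>lborel)"
      using point by (intro nn_integral_mono) (auto simp: indicator_def)
    also have "\<dots> = ennreal (C4 * E powr (q / p - 1)) * (\<integral>\<^sup>+y\<in>\<Omega>. ?Q y \<partial>lborel)"
    proof (rule nn_integral_cmult)
      show "(\<lambda>y. ?Q y * indicator \<Omega> y) \<in> borel_measurable lborel"
        unfolding weighted_energy_def by measurable
    qed
    also have "\<dots> \<le> ennreal (C4 * E powr (q / p - 1)) * (ennreal C1 * ennreal E)"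
      using int_le[OF fm, of p s b] mult_left_mono[OF total, of "ennreal C1"]
      by (intro mult_left_mono) (auto intro: order_trans)
    also have "\<dots> = ennreal (C4 * E powr (q / p - 1) * (C1 * E))"
      using C1 C4 E by (simp add: ennreal_mult)
    also have "C4 * E powr (q / p - 1) * (C1 * E) = C * E powr (q / p)"
      using E by (simp add: C_def powr_diff)
    finally show "(\<integral>\<^sup>+y\<in>\<Omega>. ennreal (\<bar>f y - ?c\<bar> powr q * d y powr a) \<partial>lborel) \<le> ennreal (C * E powr (q / p))" .
  qed
qed

section \<open>The Sobolev-Poincare inequality\<close>

lemma total_osc_le:
  assumes s: "s > 0" and p: "p \<ge> 1" and b: "0 \<le> b" "b' \<le> b"
  obtains C where "C > 0" "\<And>f. f \<in> borel_measurable borel \<Longrightarrow>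
    (\<Sum>k. \<integral>\<^sup>+x. osc_density f p s b k x \<partial>lborel) \<le> ennreal C *
     (\<integral>\<^sup>+x\<in>\<Omega>. (\<integral>\<^sup>+z\<in>{z. norm (x - z) \<le> d x / 2}.
       ennreal (\<bar>f z - f x\<bar> powr p / norm (z - x) powr (real DIM('a) + s * p) * min (d x) (d z) powr b') \<partial>lborel) \<partial>lborel)"
proof -
  obtain B where B: "\<And>x. x \<in> \<Omega> \<Longrightarrow> norm x \<le> B" using bounded_dom by (auto simp: bounded_iff)
  have R: "d x \<le> d 0 + B" if "x \<in> \<Omega>" for x using bdist_le[of x 0] B[OF that] by simp
  let ?F = "\<lambda>f x z. \<bar>f z - f x\<bar> powr p / norm (z - x) powr (real DIM('a) + s * p) * min (d x) (d z) powr b'"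
  obtain C where C: "C > 0" and sum: "\<And>f x z. (\<Sum>k. osc f p s b k x z) \<le> ennreal C *
     (indicator \<Omega> x * (indicator {z. norm (x - z) \<le> d x / 2} z * ennreal (?F f x z)))"
    using osc_sum_le[OF s p b R] by blast
  show ?thesis
  proof (rule that[OF C])
    fix f :: "'a \<Rightarrow> real" assume fm[measurable]: "f \<in> borel_measurable borel"
    note osc_measurable_pair[OF fm, measurable] osc_density_measurable[OF fm, measurable]
    have osc1: "(\<lambda>z. osc f p s b k x z) \<in> borel_measurable lborel" for k x
      using measurable_compose_Pair1[OF _ osc_measurable_pair[OF fm], of x p s b k] by simp
    have pm: "(\<lambda>(x, z). if x \<in> \<Omega> \<and> norm (x - z) \<le> d x / 2 then ennreal (?F f x z) else 0)
       \<in> borel_measurable (lborel \<Otimes>\<^sub>M lborel)"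
      by measurable
    let ?G = "\<lambda>x z. indicator \<Omega> x * (indicator {z. norm (x - z) \<le> d x / 2} z * ennreal (?F f x z))"
    have Geq: "?G x z = (if x \<in> \<Omega> \<and> norm (x - z) \<le> d x / 2 then ennreal (?F f x z) else 0)" for x z
      by (auto simp: indicator_def)
    have G2: "(\<lambda>(x, z). ?G x z) \<in> borel_measurable (lborel \<Otimes>\<^sub>M lborel)"
      unfolding Geq by (rule pm)
    have G1: "(\<lambda>z. ?G x z) \<in> borel_measurable lborel" for x
      using measurable_compose_Pair1[OF _ G2, of x] by simp
    have G3: "(\<lambda>x. \<integral>\<^sup>+z. ?G x z \<partial>lborel) \<in> borel_measurable lborel"
      by (rule lborel.borel_measurable_nn_integral[OF G2])
    have "(\<Sum>k. \<integral>\<^sup>+x. osc_density f p s b k x \<partial>lborel) = (\<integral>\<^sup>+x. (\<Sum>k. osc_density f p s b k x) \<partial>lborel)"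
      by (rule nn_integral_suminf[symmetric]) simp
    also have "\<dots> = (\<integral>\<^sup>+x. (\<integral>\<^sup>+z. (\<Sum>k. osc f p s b k x z) \<partial>lborel) \<partial>lborel)"
      unfolding osc_density_def using osc1 by (simp add: nn_integral_suminf)
    also have "\<dots> \<le> (\<integral>\<^sup>+x. (\<integral>\<^sup>+z. ennreal C * ?G x z \<partial>lborel) \<partial>lborel)"
      by (intro nn_integral_mono sum)
    also have "\<dots> = ennreal C * (\<integral>\<^sup>+x. (\<integral>\<^sup>+z. ?G x z \<partial>lborel) \<partial>lborel)"
      by (simp only: nn_integral_cmult[OF G1] nn_integral_cmult[OF G3])
    also have "(\<integral>\<^sup>+x. (\<integral>\<^sup>+z. ?G x z \<partial>lborel) \<partial>lborel)
       = (\<integral>\<^sup>+x\<in>\<Omega>. (\<integral>\<^sup>+z\<in>{z. norm (x - z) \<le> d x / 2}. ennreal (?F f x z) \<partial>lborel) \<partial>lborel)"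
    proof (intro nn_integral_cong)
      fix x
      show "(\<integral>\<^sup>+z. ?G x z \<partial>lborel) = (\<integral>\<^sup>+z\<in>{z. norm (x - z) \<le> d x / 2}. ennreal (?F f x z) \<partial>lborel) * indicator \<Omega> x"
        by (cases "x \<in> \<Omega>") (simp_all add: mult.commute)
    qed
    finally show "(\<Sum>k. \<integral>\<^sup>+x. osc_density f p s b k x \<partial>lborel) \<le> ennreal C *
     (\<integral>\<^sup>+x\<in>\<Omega>. (\<integral>\<^sup>+z\<in>{z. norm (x - z) \<le> d x / 2}. ennreal (?F f x z) \<partial>lborel) \<partial>lborel)" .
  qed
qed

text \<open>
  It suffices to treat the largest admissible \<open>b\<close>, called \<open>\<beta>\<close>, which is nonnegative by
  \<open>sub\<close>; the loss is absorbed in \<open>osc_sum_le\<close>. Values of \<open>f\<close> outside \<open>\<Omega>\<close> do not enter, so \<open>f\<close> is set to 0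
  there, which makes it Borel measurable.
\<close>
lemma sobolev_poincare:
  assumes s: "s > 0" and p: "p \<ge> 1" and q: "p \<le> q" and a: "a \<ge> 0"
    and sub: "real DIM('a) / p - real DIM('a) / q \<le> s"
    and b: "b \<le> (real DIM('a) + a) * p / q + s * p - real DIM('a)"
  shows "\<exists>C>0. \<forall>f. continuous_on \<Omega> f \<longrightarrow>
    (INF c. weighted_Lnorm q a \<Omega> (\<lambda>x. f x - c)) \<le> ennreal C * ennreal_powr
      (\<integral>\<^sup>+x\<in>\<Omega>. (\<integral>\<^sup>+z\<in>{z. norm (x - z) \<le> d x / 2}.
       ennreal (\<bar>f z - f x\<bar> powr p / norm (z - x) powr (real DIM('a) + s * p) * min (d x) (d z) powr b) \<partial>lborel) \<partial>lborel)
      (1 / p)"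
proof -
  let ?n = "real DIM('a)"
  have p0: "p > 0" and q0: "q > 0" using p q by auto
  define \<beta> where "\<beta> = (?n + a) * p / q + s * p - ?n"
  have be: "\<beta> / p = a / q + (s - ?n / p + ?n / q)"
    using p0 q0 by (simp add: \<beta>_def field_simps)
  have "\<beta> / p \<ge> 0" unfolding be using a q0 sub by simp
  then have be0: "\<beta> \<ge> 0" using p0 by (simp add: zero_le_divide_iff)
  let ?H = "\<lambda>f. (\<integral>\<^sup>+x\<in>\<Omega>. (\<integral>\<^sup>+z\<in>{z. norm (x - z) \<le> d x / 2}.
       ennreal (\<bar>f z - f x\<bar> powr p / norm (z - x) powr (?n + s * p) * min (d x) (d z) powr b) \<partial>lborel) \<partial>lborel)"
  obtain C1 where C1: "C1 > 0" and tot: "\<And>f. f \<in> borel_measurable borel \<Longrightarrow>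
    (\<Sum>k. \<integral>\<^sup>+x. osc_density f p s \<beta> k x \<partial>lborel) \<le> ennreal C1 * ?H f"
    using total_osc_le[OF s p be0 b[folded \<beta>_def]] by blast
  obtain C2 where C2: "C2 > 0" and dev: "\<And>f E. f \<in> borel_measurable borel \<Longrightarrow> continuous_on \<Omega> f \<Longrightarrow> E > 0 \<Longrightarrow>
       (\<Sum>k. \<integral>\<^sup>+x. osc_density f p s \<beta> k x \<partial>lborel) \<le> ennreal E \<Longrightarrow>
       (\<integral>\<^sup>+y\<in>\<Omega>. ennreal (\<bar>f y - avg f (ball 0 (lam / 16))\<bar> powr q * d y powr a) \<partial>lborel)
         \<le> ennreal (C2 * E powr (q / p))"
    using deviation_integral_le[OF s p q a sub be] by blast
  define C where "C = C2 powr (1 / q) * C1 powr (1 / p)"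
  have C: "C > 0" using C1 C2 by (simp add: C_def)
  have main: "(INF c. weighted_Lnorm q a \<Omega> (\<lambda>x. f x - c)) \<le> ennreal C * ennreal_powr (?H f) (1 / p)"
    if fc: "continuous_on \<Omega> f" for f
  proof (cases "?H f = \<infinity>")
    case True
    then show ?thesis using C by (simp add: ennreal_powr_def ennreal_mult_top)
  next
    case False
    then obtain e where e: "e \<ge> 0" "?H f = ennreal e" by (cases "?H f") auto
    define g where "g x = indicator \<Omega> x * f x" for x
    have gf: "g x = f x" if "x \<in> \<Omega>" for x using that by (simp add: g_def)
    have gm: "g \<in> borel_measurable borel"
    proof -
      have "(\<lambda>x. indicator \<Omega> x *\<^sub>R f x) \<in> borel_measurable borel"
        using fc by (intro borel_measurable_continuous_on_indicator) auto
      then show ?thesis by (simp add: g_def[abs_def])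
    qed
    have gc: "continuous_on \<Omega> g" using fc by (simp add: gf cong: continuous_on_cong)
    have Hg: "?H g = ?H f"
    proof (intro nn_integral_cong)
      fix x
      have "(\<integral>\<^sup>+z\<in>{z. norm (x - z) \<le> d x / 2}. ennreal (\<bar>g z - g x\<bar> powr p / norm (z - x) powr (?n + s * p) * min (d x) (d z) powr b) \<partial>lborel)
         = (\<integral>\<^sup>+z\<in>{z. norm (x - z) \<le> d x / 2}. ennreal (\<bar>f z - f x\<bar> powr p / norm (z - x) powr (?n + s * p) * min (d x) (d z) powr b) \<partial>lborel)"
        if x: "x \<in> \<Omega>"
      proof (intro nn_integral_cong)
        fix z
        have "z \<in> \<Omega>" if "norm (x - z) \<le> d x / 2"
          using that bdist_pos[OF x] by (intro in_dom_near[OF x]) (simp add: dist_norm)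
        then show "ennreal (\<bar>g z - g x\<bar> powr p / norm (z - x) powr (?n + s * p) * min (d x) (d z) powr b) * indicator {z. norm (x - z) \<le> d x / 2} z
          = ennreal (\<bar>f z - f x\<bar> powr p / norm (z - x) powr (?n + s * p) * min (d x) (d z) powr b) * indicator {z. norm (x - z) \<le> d x / 2} z"
          using gf x by (auto simp: indicator_def)
      qed
      then show "(\<integral>\<^sup>+z\<in>{z. norm (x - z) \<le> d x / 2}. ennreal (\<bar>g z - g x\<bar> powr p / norm (z - x) powr (?n + s * p) * min (d x) (d z) powr b) \<partial>lborel) * indicator \<Omega> x
         = (\<integral>\<^sup>+z\<in>{z. norm (x - z) \<le> d x / 2}. ennreal (\<bar>f z - f x\<bar> powr p / norm (z - x) powr (?n + s * p) * min (d x) (d z) powr b) \<partial>lborel) * indicator \<Omega> x"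
        by (simp add: indicator_def)
    qed
    let ?c = "avg g (ball 0 (lam / 16))"
    have bound: "weighted_Lnorm q a \<Omega> (\<lambda>x. f x - ?c) \<le> ennreal (C2 powr (1 / q) * E powr (1 / p))"
      if E: "E > 0" "C1 * e \<le> E" for E
    proof -
      have "(\<Sum>k. \<integral>\<^sup>+x. osc_density g p s \<beta> k x \<partial>lborel) \<le> ennreal (C1 * e)"
        using tot[OF gm] C1 e(1) unfolding Hg e(2) by (simp add: ennreal_mult)
      also have "\<dots> \<le> ennreal E" using E by (intro ennreal_leI)
      finally have "(\<integral>\<^sup>+y\<in>\<Omega>. ennreal (\<bar>g y - ?c\<bar> powr q * d y powr a) \<partial>lborel) \<le> ennreal (C2 * E powr (q / p))"
        by (rule dev[OF gm gc E(1)])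
      moreover have "(\<integral>\<^sup>+y\<in>\<Omega>. ennreal (\<bar>g y - ?c\<bar> powr q * d y powr a) \<partial>lborel)
         = (\<integral>\<^sup>+y\<in>\<Omega>. ennreal (\<bar>f y - ?c\<bar> powr q * d y powr a) \<partial>lborel)"
        by (intro nn_integral_cong) (auto simp: indicator_def gf)
      ultimately have le: "(\<integral>\<^sup>+y\<in>\<Omega>. ennreal (\<bar>f y - ?c\<bar> powr q * d y powr a) \<partial>lborel) \<le> ennreal (C2 * E powr (q / p))"
        by simp
      then obtain i where i: "i \<ge> 0" "(\<integral>\<^sup>+y\<in>\<Omega>. ennreal (\<bar>f y - ?c\<bar> powr q * d y powr a) \<partial>lborel) = ennreal i"
        by (cases "\<integral>\<^sup>+y\<in>\<Omega>. ennreal (\<bar>f y - ?c\<bar> powr q * d y powr a) \<partial>lborel") (auto simp: top_unique)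
      have "i \<le> C2 * E powr (q / p)" using le i C2 by simp
      then have "i powr (1 / q) \<le> (C2 * E powr (q / p)) powr (1 / q)"
        using i q0 by (intro powr_mono2) auto
      also have "\<dots> = C2 powr (1 / q) * E powr (1 / p)"
        using q0 C2 E by (simp add: powr_mult powr_powr)
      finally show ?thesis
        unfolding weighted_Lnorm_def i(2) ennreal_powr_def using i by (simp add: ennreal_leI)
    qed
    have inf: "(INF c. weighted_Lnorm q a \<Omega> (\<lambda>x. f x - c)) \<le> ennreal (C2 powr (1 / q) * E powr (1 / p))"
      if E: "E > 0" "C1 * e \<le> E" for E
      using bound[OF E] by (rule INF_lower2[OF UNIV_I])
    show ?thesis
    proof (cases "e = 0")
      case False
      then have "C1 * e > 0" using e C1 by simp
      from inf[OF this] show ?thesis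
        using e C1 C2 False by (simp add: C_def ennreal_powr_def powr_mult mult.assoc flip: ennreal_mult)
    next
      case True
      have "(INF c. weighted_Lnorm q a \<Omega> (\<lambda>x. f x - c)) \<le> 0"
      proof (rule ennreal_le_epsilon)
        fix x :: real assume x: "x > 0"
        \<comment> \<open>the energy vanishes: any positive \<open>E\<close> is admissible, and this one makes the bound equal to \<open>x\<close>\<close>
        define E where "E = (x / C2 powr (1 / q)) powr p"
        have "E > 0" using x C2 by (simp add: E_def)
        moreover have "C2 powr (1 / q) * E powr (1 / p) = x"
          using x C2 p0 by (simp add: E_def powr_powr)
        ultimately show "(INF c. weighted_Lnorm q a \<Omega> (\<lambda>x. f x - c)) \<le> 0 + ennreal x"
          using inf[of E] True by simp
      qed
      then show ?thesis by (simp add: order_trans[OF _ zero_le])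
    qed
  qed
  show ?thesis using C main by blast
qed

end

theorem theorem3p1:
  fixes \<Omega> :: "(real ^ 'n::finite) set" and s p q a b :: real
  assumes "CARD('n) \<ge> 2"
    and "john_domain \<Omega>"
    and "0 < s" "s < 1"
    and "1 < p" "p \<le> q"
    and "a \<ge> 0"
    and "b \<le> (real CARD('n) + a) * p / q + s * p - real CARD('n)"
    and "p < real CARD('n) / s \<Longrightarrow> q \<le> real CARD('n) * p / (real CARD('n) - s * p)"
  shows "\<exists>C::real. C > 0 \<and> (\<forall>f :: real ^ 'n \<Rightarrow> real. Cinf_on f \<Omega> \<longrightarrow>
    (INF c::real. weighted_Lnorm q a \<Omega> (\<lambda>x. f x - c)) \<le>
    ennreal C * ennreal_powr
      (\<integral>\<^sup>+ x \<in> \<Omega>.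
        (\<integral>\<^sup>+ z \<in> {z. norm (x - z) \<le> bdist \<Omega> x / 2}.
          ennreal (\<bar>f z - f x\<bar> powr p / norm (z - x) powr (real CARD('n) + s * p)
                   * min (bdist \<Omega> x) (bdist \<Omega> z) powr b) \<partial>lborel) \<partial>lborel)
      (1 / p))"
proof -
  let ?n = "real CARD('n)"
  obtain \<gamma> lam0 K0 where dom: "open \<Omega>" "bounded \<Omega>" "0 \<in> \<Omega>" and pos: "lam0 > 0" "K0 > 0"
    and ex_lip: "\<And>y. y \<in> \<Omega> \<Longrightarrow> \<exists>L. L-lipschitz_on {0..1} (\<lambda>t. \<gamma> t y)"
    and ends: "\<And>y. y \<in> \<Omega> \<Longrightarrow> \<gamma> 0 y = y \<and> \<gamma> 1 y = 0"
    and inside: "\<And>y t. y \<in> \<Omega> \<Longrightarrow> t \<in> {0..1} \<Longrightarrow> \<gamma> t y \<in> \<Omega> \<and> bdist \<Omega> (\<gamma> t y) \<ge> lam0 * t"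
    and speed: "\<And>y. y \<in> \<Omega> \<Longrightarrow> AE t in lebesgue_on {0..1}. (\<lambda>t. \<gamma> t y) differentiable (at t) \<and>
              norm (vector_derivative (\<lambda>t. \<gamma> t y) (at t)) \<le> K0"
    using assms(2) unfolding john_domain_def by blast
  interpret john_curves \<Omega> \<gamma> "min lam0 1" "max K0 1"
  proof
    fix y t assume y: "y \<in> \<Omega>"
    show "\<gamma> 0 y = y" "\<gamma> 1 y = 0" using ends[OF y] by auto
    obtain L where "L-lipschitz_on {0..1} (\<lambda>t. \<gamma> t y)" using ex_lip[OF y] by blast
    then have "K0-lipschitz_on {0..1} (\<lambda>t. \<gamma> t y)"
      by (rule lipschitz_on_of_speed_bound_AE[OF _ speed[OF y]]) (use pos in simp)
    then show "(max K0 1)-lipschitz_on {0..1} (\<lambda>t. \<gamma> t y)" by (rule lipschitz_on_mono) auto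
    assume t: "t \<in> {0..1::real}"
    show "\<gamma> t y \<in> \<Omega>" using inside[OF y t] by auto
    have "min lam0 1 * t \<le> lam0 * t" using t by (intro mult_right_mono) auto
    then show "min lam0 1 * t \<le> bdist \<Omega> (\<gamma> t y)" using inside[OF y t] by linarith
  qed (use dom pos in auto)
  have p0: "p > 0" and q0: "q > 0" using assms by auto
  \<comment> \<open>the hypothesis on \<open>q\<close>, in the form that covers both ranges of \<open>p\<close>\<close>
  have sub: "?n / p - ?n / q \<le> s"
  proof (cases "p < ?n / s")
    case True
    then have "?n - s * p > 0" using assms(3) by (simp add: field_simps)
    then have "q * (?n - s * p) \<le> ?n * p" using assms(9)[OF True] by (simp add: field_simps)
    then show ?thesis using p0 q0 by (simp add: field_simps)
  next
    case False
    then have "?n / p \<le> s" using assms(3) p0 by (simp add: field_simps)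
    moreover have "?n / q \<ge> 0" using q0 by simp
    ultimately show ?thesis by linarith
  qed
  have "\<exists>C>0. \<forall>f. continuous_on \<Omega> f \<longrightarrow>
    (INF c. weighted_Lnorm q a \<Omega> (\<lambda>x. f x - c)) \<le> ennreal C * ennreal_powr
      (\<integral>\<^sup>+x\<in>\<Omega>. (\<integral>\<^sup>+z\<in>{z. norm (x - z) \<le> bdist \<Omega> x / 2}.
       ennreal (\<bar>f z - f x\<bar> powr p / norm (z - x) powr (?n + s * p) * min (bdist \<Omega> x) (bdist \<Omega> z) powr b) \<partial>lborel) \<partial>lborel)
      (1 / p)"
    using sobolev_poincare[of s p q a b] assms sub by simp
  moreover have "continuous_on \<Omega> f" if "Cinf_on f \<Omega>" for f :: "real ^ 'n \<Rightarrow> real"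
    using that unfolding Cinf_on_def by (metis Ck_on.simps(1))
  ultimately show ?thesis by blast
qed

end
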